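(* Let $\mathcal{M}=(S,\mathcal{A},\mathcal{P},s_0)$ be a finite MDP with observed states $W\subseteq S$ and let $\pi\in\Pi^{St}(\mathcal{M})$ be a stationary policy. For $w\in W$ let $\sigma_w$ be the mean squared error of an unbiased estimator of the transition probabilities $(\mathcal{P}^{\pi}_{w,q})_{q\in Succ(w)}$ at $w$, where the observed data are the whole path of the agent and the transition probabilities at all states in $S\setminus\{w\}$ are known. Then for every $w\in W$, $$\sigma_w\ \ge\ \frac{\Pr^{\pi}(Reach[w])^2}{x^{\pi}_w\,\iota^{\pi}_w}.$$
   Context: An MDP has finite state set $S$, finite action set $\mathcal{A}$, available actions $\mathcal{A}(s)$, transition probabilities $\mathcal{P}_{s,a,q}$ with $\sum_q\mathcal{P}_{s,a,q}=1$ for $a\in\mathcal{A}(s)$, and initial state $s_0$. $Succ(s)=\{q:\exists a\in\mathcal{A}(s),\ \mathcal{P}_{s,a,q}>0\}$. A stationary policy $\pi$ assigns to each $s$ a distribution $(\pi_{s,a})_{a\in\mathcal{A}(s)}$ and induces a Markov chain from $s_0$ with transition probabilities $\mathcal{P}^{\pi}_{s,q}=\sum_a\pi_{s,a}\mathcal{P}_{s,a,q}$. $\Pr^{\pi}(Reach[w])$ is the probability that the random path $\xi=s_0s_1\ldots$ ever visits $w$; $x^{\pi}_w=\sum_{t\ge0}\Pr(s_t=w\mid s_0)$ is the expected state residence time; $\iota^{\pi}_w=\big(\sum_{q\in Succ(w)}\mathcal{P}^{\pi}_{w,q}(1-\mathcal{P}^{\pi}_{w,q})\big)^{-1}\in(0,\infty]$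 is the transition information ($\infty$ if the sum is $0$). Estimation setting at $w$: the unknown parameter is the transition distribution $\theta=(\theta_q)_{q\in Succ(w)}$ at $w$, with true value $\theta=\mathcal{P}^\pi_w$. For each probability vector $\theta$ on $Succ(w)$, consider the Markov chain from $s_0$ with transition distribution $\theta$ at $w$ and the known distributions $\mathcal{P}^{\pi}_{s,\cdot}$ at $s\neq w$. An estimator is a measurable function $\hat\theta$ of the whole infinite path $\xi$ with values in $\mathbb{R}^{Succ(w)}$; it is unbiased if $\mathbb{E}_\theta[\hat\theta]=\theta$ for all such $\theta$. Its mean squared error is $\sigma_w=\sum_{q\in Succ(w)}\mathbb{E}\big[(\hat\theta_q-\mathcal{P}^{\pi}_{w,q})^2\big]$, expectation under $\theta=\mathcal{P}^{\pi}_w$. Conventions: $x^{\pi}_w\iota^{\pi}_w=0$ if $x^{\pi}_w=0$, and $x^{\pi}_w\iota^{\pi}_w=\infty$ if $x^{\pi}_w=\infty$ or if $x^\pi_w>0$ and $\iota^{\pi}_w=\infty$; a quotient with infinite denominator is $0$ (the Cramér–Rao lower bound is taken to be zero when the Fisher information is infinite); the quotient $0/0$ (arising when $w$ is unreachable) is read as $0$. *)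

theory Defs
  imports "HOL-Probability.Probability"
begin

section \<open>Markov chains on infinite paths\<close>

abbreviation path_space :: "(nat \<Rightarrow> 's) measure"
  where "path_space \<equiv> PiM UNIV (\<lambda>_. count_space UNIV)"

text \<open>The law of the state at time \<open>n\<close>, given the earlier states \<open>\<omega> 0, \<dots>, \<omega> (n - 1)\<close>.\<close>

definition step_kernel :: "('s \<Rightarrow> 's pmf) \<Rightarrow> 's \<Rightarrow> nat \<Rightarrow> (nat \<Rightarrow> 's) \<Rightarrow> 's measure"
  where "step_kernel K s0 n \<omega> =
    (case n of 0 \<Rightarrow> measure_pmf (return_pmf s0) | Suc m \<Rightarrow> measure_pmf (K (\<omega> m)))"

text \<open>
  The law of the path \<open>\<omega> 0, \<omega> 1, \<dots>\<close> of the Markov chain started in \<open>s0\<close> with transition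
  distributions \<open>K\<close> is the Ionescu-Tulcea limit; lemma \<open>emeasure_path_measure_cylinder\<close> gives its
  values on cylinder sets.
\<close>

definition path_measure :: "('s \<Rightarrow> 's pmf) \<Rightarrow> 's \<Rightarrow> (nat \<Rightarrow> 's) measure"
  where "path_measure K s0 =
    projective_family.lim UNIV
      (Ionescu_Tulcea.CI (step_kernel K s0) (\<lambda>_. count_space UNIV)) (\<lambda>_. count_space UNIV)"

lemma Ionescu_Tulcea_step_kernel:
  fixes K :: "'s \<Rightarrow> 's pmf"
  shows "Ionescu_Tulcea (step_kernel K s0) (\<lambda>_. count_space UNIV)"
proof (rule Ionescu_Tulcea.intro)
  fix n :: nat
  show "step_kernel K s0 n \<in>
      measurable (PiM {0..<n} (\<lambda>_. count_space UNIV)) (subprob_algebra (count_space UNIV))"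
  proof (cases n)
    case 0
    then show ?thesis
      by (simp add: step_kernel_def[abs_def] measure_pmf_in_subprob_algebra)
  next
    case (Suc m)
    have "(\<lambda>\<omega>. measure_pmf (K (\<omega> m))) \<in>
        measurable (PiM {0..<n} (\<lambda>_. count_space UNIV)) (subprob_algebra (count_space UNIV))"
      by (rule measurable_compose[OF measurable_component_singleton[of m]])
        (auto simp: Suc measure_pmf_in_subprob_algebra)
    then show ?thesis
      by (simp add: step_kernel_def[abs_def] Suc)
  qed
next
  fix n :: nat and \<omega> :: "nat \<Rightarrow> 's"
  show "prob_space (step_kernel K s0 n \<omega>)"
    by (auto simp: step_kernel_def measure_pmf.prob_space_axioms split: nat.split)
qed

lemma sets_path_measure [simp, measurable_cong]:
  "sets (path_measure K s0) = sets path_space"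
proof -
  interpret Ionescu_Tulcea "step_kernel K s0" "\<lambda>_. count_space UNIV"
    by (rule Ionescu_Tulcea_step_kernel)
  show ?thesis
    by (simp add: path_measure_def)
qed

lemma space_path_measure [simp]: "space (path_measure K s0) = UNIV"
  using sets_eq_imp_space_eq[OF sets_path_measure[of K s0]] by (simp add: space_PiM)

lemma emeasure_path_measure_cylinder:
  "emeasure (path_measure K s0) {\<omega>. \<forall>i\<le>n. \<omega> i = x i} =
    ennreal (indicator {s0} (x 0) * (\<Prod>i<n. pmf (K (x i)) (x (Suc i))))"
proof -
  let ?M = "\<lambda>_::nat. count_space (UNIV :: 'a set)"
  interpret Ionescu_Tulcea "step_kernel K s0" ?M
    by (rule Ionescu_Tulcea_step_kernel)
  define r where "r m = restrict x {0..<m}" for m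
  have r_sing: "{r m} = PiE {0..<m} (\<lambda>i. {x i})" for m
    by (auto simp: r_def PiE_iff extensional_def fun_eq_iff)
  have r_sets[measurable]: "{r m} \<in> sets (PiM {0..<m} ?M)" for m
    unfolding r_sing by (rule sets_PiM_I_finite) auto
  have r_space: "\<omega> \<in> extensional {0..<m}" if "\<omega> \<in> space (PiM {0..<m} ?M)" for m \<omega>
    using that by (simp add: space_PiM PiE_iff)
  have und: "(\<lambda>x. undefined) \<in> space (PiM {0..<0} ?M)"
    by (simp add: space_PiM)
  have C_sing: "emeasure (C 0 m (\<lambda>x. undefined)) {r m} =
      (\<Prod>i<m. emeasure (step_kernel K s0 i x) {x i})" for m
  proof (induction m)
    case 0
    have "r 0 = (\<lambda>x. undefined)"
      by (simp add: r_def restrict_def)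
    then show ?case
      using r_sets[of 0] by simp
  next
    case (Suc m)
    have eP_sing: "emeasure (eP m \<omega>) {r (Suc m)} =
        emeasure (step_kernel K s0 m x) {x m} * indicator {r m} \<omega>"
      if \<omega>: "\<omega> \<in> space (PiM {0..<m} ?M)" for \<omega>
    proof -
      have sk: "step_kernel K s0 m (r m) = step_kernel K s0 m x"
        by (auto simp: step_kernel_def r_def split: nat.split)
      have eq: "(fun_upd \<omega> m -` {r (Suc m)}) \<inter> space (count_space UNIV) =
          (if \<omega> = r m then {x m} else {})"
        using r_space[OF \<omega>]
        by (auto simp: r_def fun_eq_iff extensional_def restrict_def; metis less_SucE less_irrefl less_Suc_eq)
      show ?thesis
        unfolding emeasure_eP[OF \<omega> r_sets] eq using sk by auto
    qed
    have "emeasure (C 0 (Suc m) (\<lambda>x. undefined)) {r (Suc m)} =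
        (\<integral>\<^sup>+\<omega>. emeasure (eP m \<omega>) {r (Suc m)} \<partial>C 0 m (\<lambda>x. undefined))"
      unfolding C.simps
      apply (subst emeasure_bind[where N="PiM {0..<Suc m} ?M"])
      using und measurable_eP[of m]
      by (auto simp: space_C measurable_cong_sets[OF sets_C[OF und] refl])
    also have "\<dots> = (\<integral>\<^sup>+\<omega>. emeasure (step_kernel K s0 m x) {x m} * indicator {r m} \<omega>
        \<partial>C 0 m (\<lambda>x. undefined))"
      by (intro nn_integral_cong eP_sing) (simp add: space_C[OF und])
    also have "\<dots> = emeasure (step_kernel K s0 m x) {x m} *
        emeasure (C 0 m (\<lambda>x. undefined)) {r m}"
      using r_sets[of m] by (subst nn_integral_cmult_indicator) (auto simp: sets_C[OF und])
    finally show ?case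
      by (simp add: Suc.IH mult.commute)
  qed
  have "{\<omega>. \<forall>i\<le>n. \<omega> i = x i} = PF.emb UNIV {0..<Suc n} {r (Suc n)}"
    by (auto simp: prod_emb_def r_def fun_eq_iff restrict_def less_Suc_eq_le) metis
  then have "emeasure (path_measure K s0) {\<omega>. \<forall>i\<le>n. \<omega> i = x i} = emeasure (CI {0..<Suc n}) {r (Suc n)}"
    unfolding path_measure_def using lim[of "{0..<Suc n}" "{r (Suc n)}"] r_sets[of "Suc n"] by simp
  also have "\<dots> = emeasure (C 0 (Suc n) (\<lambda>x. undefined)) {r (Suc n)}"
  proof -
    have "prod_emb {0..<Suc n} ?M {0..<Suc n} {r (Suc n)} = {r (Suc n)}"
      by (rule prod_emb_id) (auto simp: r_def)
    then show ?thesis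
      by (subst emeasure_CI[of _ "Suc n"]) (use r_sets[of "Suc n"] in auto)
  qed
  also have "\<dots> = (\<Prod>i<Suc n. emeasure (step_kernel K s0 i x) {x i})"
    by (rule C_sing)
  also have "\<dots> = emeasure (step_kernel K s0 0 x) {x 0} *
      (\<Prod>i<n. emeasure (step_kernel K s0 (Suc i) x) {x (Suc i)})"
    by (rule prod.lessThan_Suc_shift)
  also have "\<dots> = ennreal (indicator {s0} (x 0)) * (\<Prod>i<n. ennreal (pmf (K (x i)) (x (Suc i))))"
    by (auto simp: step_kernel_def emeasure_pmf_single indicator_def pmf_return)
  also have "\<dots> = ennreal (indicator {s0} (x 0) * (\<Prod>i<n. pmf (K (x i)) (x (Suc i))))"
    by (simp add: prod_ennreal ennreal_mult prod_nonneg)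
  finally show ?thesis .
qed

lemma prob_space_path_measure: "prob_space (path_measure K s0)"
proof -
  interpret Ionescu_Tulcea "step_kernel K s0" "\<lambda>_. count_space UNIV"
    by (rule Ionescu_Tulcea_step_kernel)
  interpret C: prob_space "CI {}"
    by (rule PF.prob_space_P) auto
  have "prod_emb UNIV (\<lambda>_. count_space UNIV) {} (space (CI {})) = (UNIV :: (nat \<Rightarrow> 'a) set)"
    by (auto simp: prod_emb_def CI_def space_PiM)
  then have "emeasure PF.lim UNIV = 1"
    using lim[of "{}" "space (CI {})"] C.emeasure_space_1 by (simp add: CI_def)
  then show ?thesis
    by (intro prob_spaceI) (simp add: path_measure_def[symmetric])
qed

definition reach_prob :: "('s \<Rightarrow> 's pmf) \<Rightarrow> 's \<Rightarrow> 's \<Rightarrow> ennreal"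
  where "reach_prob K s0 w = emeasure (path_measure K s0) {\<omega>. \<exists>t. \<omega> t = w}"

definition residence_time :: "('s \<Rightarrow> 's pmf) \<Rightarrow> 's \<Rightarrow> 's \<Rightarrow> ennreal"
  where "residence_time K s0 w = (\<Sum>t. emeasure (path_measure K s0) {\<omega>. \<omega> t = w})"


section \<open>Markov decision processes and stationary policies\<close>

text \<open>
  \<open>transition M s a\<close> is meaningful only for \<open>a \<in> avail M s\<close>; its values for other \<open>a\<close> are never used.
\<close>

record ('s, 'a) mdp =
  avail :: "'s \<Rightarrow> 'a set"
  transition :: "'s \<Rightarrow> 'a \<Rightarrow> 's pmf"
  init :: 's

definition Succ :: "('s, 'a) mdp \<Rightarrow> 's \<Rightarrow> 's set"
  where "Succ M s = {q. \<exists>a \<in> avail M s. pmf (transition M s a) q > 0}"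

definition stationary_policies :: "('s, 'a) mdp \<Rightarrow> ('s \<Rightarrow> 'a pmf) set"
  where "stationary_policies M = {\<pi>. \<forall>s. set_pmf (\<pi> s) \<subseteq> avail M s}"

definition induced_chain :: "('s, 'a) mdp \<Rightarrow> ('s \<Rightarrow> 'a pmf) \<Rightarrow> 's \<Rightarrow> 's pmf"
  where "induced_chain M \<pi> s = bind_pmf (\<pi> s) (transition M s)"

lemma pmf_induced_chain:
  fixes M :: "('s, 'a::finite) mdp"
  assumes "\<pi> \<in> stationary_policies M"
  shows "pmf (induced_chain M \<pi> s) q = (\<Sum>a\<in>avail M s. pmf (\<pi> s) a * pmf (transition M s a) q)"
proof -
  have "pmf (induced_chain M \<pi> s) q = (\<Sum>a\<in>avail M s. pmf (transition M s a) q * pmf (\<pi> s) a)"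
    unfolding induced_chain_def pmf_bind
    by (rule integral_measure_pmf_real) (use assms in \<open>auto simp: stationary_policies_def\<close>)
  then show ?thesis
    by (simp add: mult.commute)
qed

text \<open>
  In \<^typ>\<open>ennreal\<close> we have \<open>inverse 0 = \<infinity>\<close>, so the transition information is \<open>\<infinity>\<close> if the transition
  at \<open>w\<close> is deterministic. Products and quotients of extended nonnegative reals follow
  \<open>0 * \<infinity> = 0\<close>, \<open>x * \<infinity> = \<infinity>\<close> for \<open>x > 0\<close>, \<open>x / \<infinity> = 0\<close> and \<open>0 / 0 = 0\<close>, so a bound of the form
  \<open>p\<^sup>2 / (x * \<iota>)\<close> needs no case distinction.
\<close>

lemma
  fixes x :: ennreal
  shows "0 * (\<infinity> :: ennreal) = 0" "x > 0 \<Longrightarrow> x * \<infinity> = \<infinity>" "x < \<infinity> \<Longrightarrow> x / \<infinity> = 0" "0 / (0 :: ennreal) = 0"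
  by (auto simp: ennreal_mult_top divide_ennreal_def)

definition transition_information :: "('s, 'a) mdp \<Rightarrow> ('s \<Rightarrow> 'a pmf) \<Rightarrow> 's \<Rightarrow> ennreal"
  where "transition_information M \<pi> w =
    inverse (ennreal (\<Sum>q\<in>Succ M w.
      pmf (induced_chain M \<pi> w) q * (1 - pmf (induced_chain M \<pi> w) q)))"


section \<open>Estimating the transition distribution at a state\<close>

text \<open>The law of the path if the unknown transition distribution at \<open>w\<close> is \<open>\<theta>\<close>.\<close>

definition model :: "('s, 'a) mdp \<Rightarrow> ('s \<Rightarrow> 'a pmf) \<Rightarrow> 's \<Rightarrow> 's pmf \<Rightarrow> (nat \<Rightarrow> 's) measure"
  where "model M \<pi> w \<theta> = path_measure ((induced_chain M \<pi>)(w := \<theta>)) (init M)"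

text \<open>
  Integrability is required explicitly, because the Bochner integral of a non-integrable function
  is \<open>0\<close> by convention.
\<close>

definition unbiased_estimator ::
    "('s, 'a) mdp \<Rightarrow> ('s \<Rightarrow> 'a pmf) \<Rightarrow> 's \<Rightarrow> ((nat \<Rightarrow> 's) \<Rightarrow> 's \<Rightarrow> real) \<Rightarrow> bool"
  where "unbiased_estimator M \<pi> w est \<longleftrightarrow>
    est \<in> path_space \<rightarrow>\<^sub>M PiM (Succ M w) (\<lambda>_. borel) \<and>
    (\<forall>\<theta>. set_pmf \<theta> \<subseteq> Succ M w \<longrightarrow>
      (\<forall>q\<in>Succ M w. integrable (model M \<pi> w \<theta>) (\<lambda>\<omega>. est \<omega> q) \<and>
        (\<integral>\<omega>. est \<omega> q \<partial>model M \<pi> w \<theta>) = pmf \<theta> q))"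

definition mean_squared_error ::
    "('s, 'a) mdp \<Rightarrow> ('s \<Rightarrow> 'a pmf) \<Rightarrow> 's \<Rightarrow> ((nat \<Rightarrow> 's) \<Rightarrow> 's \<Rightarrow> real) \<Rightarrow> ennreal"
  where "mean_squared_error M \<pi> w est =
    (\<Sum>q\<in>Succ M w. \<integral>\<^sup>+\<omega>. ennreal ((est \<omega> q - pmf (induced_chain M \<pi> w) q)\<^sup>2)
      \<partial>model M \<pi> w (induced_chain M \<pi> w))"

end

theory Submission
  imports Defs
begin

text \<open>
  Since the reach probability is at most \<open>1\<close>, it suffices to show
  \<open>\<sigma> \<ge> (\<Sum>q. p q * (1 - p q)) / x\<close>, where \<open>p\<close> is the true transition distribution at \<open>w\<close> and \<open>x\<close> the
  residence time, and this holds coordinate by coordinate: an unbiased estimator \<open>f\<close> of \<open>p q\<close> has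
  variance at least \<open>p q * (1 - p q) / x\<close> (lemma \<open>coordinate_variance_bound\<close>).

  This Cramer-Rao bound is obtained as a limit of Hammersley-Chapman-Robbins inequalities, whose
  finite differences make sense for an arbitrary measurable function of the path. Let \<open>p q > 0\<close> and
  \<open>0 < x < \<infinity>\<close>, as the bound is \<open>0\<close> otherwise. The distribution at \<open>w\<close> is moved from \<open>p\<close> to the mixture
  \<open>(1 - h) * p + h * \<delta>\<^sub>q\<close>, the direction in which \<open>p q\<close> can be estimated least accurately.
  Unbiasedness says that the mean of \<open>f\<close> changes by exactly \<open>h * (1 - p q)\<close>, and by Cauchy-Schwarz the
  square of this change is at most the variance of \<open>f\<close> times the chi-square divergence of the two path
  laws (lemma \<open>chapman_robbins\<close>).

  For paths of length \<open>n\<close> the likelihood ratio is the product of the ratios of the transition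
  probabilities, of which only those at visits to \<open>w\<close> differ from \<open>1\<close>. A visit multiplies the conditional second
  moment of this product by \<open>1 + h\<^sup>2 * (1 / p q - 1)\<close>, so that the divergence is \<open>h\<^sup>2 * (1 / p q - 1)\<close> times a
  weighted expected number of visits. Before a visit, the weight is at most \<open>(1 + \<delta>) ^ k\<close> after
  \<open>k\<close> earlier visits, where \<open>\<delta> \<rightarrow> 0\<close> as \<open>h \<rightarrow> 0\<close>. A renewal argument bounds the weighted number of visits by
  \<open>x / (1 - \<delta> * G)\<close>, where \<open>G\<close> is the expected number of visits of the chain started in \<open>w\<close>
  (lemma \<open>sum_visit_weight_le\<close>). Dividing by \<open>h\<^sup>2\<close> and letting \<open>h\<close> tend to \<open>0\<close> gives
  \<open>(1 - p q)\<^sup>2 \<le> Var f * (1 / p q - 1) * x\<close>, which is the bound for one coordinate.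

  The estimator sees the whole infinite path. As \<open>x\<close> is finite, almost every path visits \<open>w\<close>
  only finitely often, and on the paths that avoid \<open>w\<close> from time \<open>n\<close> on, the likelihood ratio of the
  first \<open>n\<close> steps is a density for the laws of the infinite paths (lemma \<open>density_not_visited_from\<close>).
\<close>


section \<open>Functions of finitely many states\<close>

text \<open>
  Over a finite state set, the functions of the first \<open>n + 1\<close> states take finitely many values. Hence they are
  measurable and integrable, and their means are finite sums over cylinders, to which the formula for the
  probability of a cylinder applies.
\<close>

definition adapted :: "nat \<Rightarrow> ((nat \<Rightarrow> 's) \<Rightarrow> real) \<Rightarrow> bool"
  where "adapted n f \<longleftrightarrow> (\<forall>\<omega> \<omega>'. (\<forall>i\<le>n. \<omega> i = \<omega>' i) \<longrightarrow> f \<omega> = f \<omega>')"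

lemma adaptedD: "adapted n f \<Longrightarrow> (\<And>i. i \<le> n \<Longrightarrow> \<omega> i = \<omega>' i) \<Longrightarrow> f \<omega> = f \<omega>'"
  unfolding adapted_def by blast

lemma adapted_mono: "adapted m f \<Longrightarrow> m \<le> n \<Longrightarrow> adapted n f"
  unfolding adapted_def by (meson order_trans)

lemma adapted_coordinate: "k \<le> n \<Longrightarrow> adapted n (\<lambda>\<omega>. \<psi> (\<omega> k))"
  by (auto simp: adapted_def)

lemma adapted_const: "adapted n (\<lambda>\<omega>. c)"
  by (auto simp: adapted_def)

lemma adapted_mult: "adapted n f \<Longrightarrow> adapted n g \<Longrightarrow> adapted n (\<lambda>\<omega>. f \<omega> * g \<omega>)"
  unfolding adapted_def by metis

lemma adapted_power: "adapted n f \<Longrightarrow> adapted n (\<lambda>\<omega>. f \<omega> ^ k)"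
  unfolding adapted_def by metis

definition cylinder :: "nat \<Rightarrow> (nat \<Rightarrow> 's) \<Rightarrow> (nat \<Rightarrow> 's) set"
  where "cylinder n x = {\<omega>. \<forall>i\<le>n. \<omega> i = x i}"

definition cylinder_prob :: "('s \<Rightarrow> 's pmf) \<Rightarrow> 's \<Rightarrow> nat \<Rightarrow> (nat \<Rightarrow> 's) \<Rightarrow> real"
  where "cylinder_prob K s n x = indicator {s} (x 0) * (\<Prod>i<n. pmf (K (x i)) (x (Suc i)))"

abbreviation prefixes :: "nat \<Rightarrow> (nat \<Rightarrow> 's) set"
  where "prefixes n \<equiv> PiE {..n} (\<lambda>_. UNIV)"

lemma measure_cylinder: "measure (path_measure K s) (cylinder n x) = cylinder_prob K s n x"
  unfolding measure_def cylinder_def emeasure_path_measure_cylinder cylinder_prob_def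
  by (simp add: prod_nonneg)

lemma sets_cylinder [measurable]: "cylinder n (x :: nat \<Rightarrow> 's::finite) \<in> sets path_space"
proof -
  have "cylinder n x = {\<omega> \<in> space path_space. \<forall>i\<le>n. \<omega> i = x i}"
    by (auto simp: cylinder_def space_PiM)
  also have "\<dots> \<in> sets path_space"
    by measurable
  finally show ?thesis .
qed

lemma finite_prefixes: "finite (prefixes n :: (nat \<Rightarrow> 's::finite) set)"
  by (intro finite_PiE) auto

lemma adapted_eq_sum_cylinders:
  fixes f :: "(nat \<Rightarrow> 's::finite) \<Rightarrow> real"
  assumes "adapted n f"
  shows "f \<omega> = (\<Sum>x\<in>prefixes n. f x * indicator (cylinder n x) \<omega>)"
proof -
  let ?x = "restrict \<omega> {..n}"
  have "(\<Sum>x\<in>prefixes n. f x * indicator (cylinder n x) \<omega>) = (\<Sum>x\<in>prefixes n. if x = ?x then f \<omega> else 0)"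
  proof (rule sum.cong)
    fix x :: "nat \<Rightarrow> 's" assume x: "x \<in> prefixes n"
    have "\<omega> \<in> cylinder n x \<longleftrightarrow> x = ?x"
      using x by (auto simp: cylinder_def PiE_def extensional_def restrict_def fun_eq_iff)
    moreover have "f ?x = f \<omega>"
      by (rule adaptedD[OF assms]) auto
    ultimately show "f x * indicator (cylinder n x) \<omega> = (if x = ?x then f \<omega> else 0)"
      by auto
  qed simp
  also have "\<dots> = f \<omega>"
    by (simp add: sum.delta[OF finite_prefixes])
  finally show ?thesis ..
qed

lemma adapted_measurable:
  fixes f :: "(nat \<Rightarrow> 's::finite) \<Rightarrow> real"
  assumes "adapted n f"
  shows "f \<in> borel_measurable path_space"
proof -
  have "(\<lambda>\<omega>. \<Sum>x\<in>prefixes n. f x * indicator (cylinder n x) \<omega>) \<in> borel_measurable path_space"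
    by measurable
  also have "(\<lambda>\<omega>. \<Sum>x\<in>prefixes n. f x * indicator (cylinder n x) \<omega>) = f"
    by (rule ext, rule adapted_eq_sum_cylinders[OF assms, symmetric])
  finally show ?thesis .
qed

lemma integrable_adapted_mult:
  fixes f :: "(nat \<Rightarrow> 's::finite) \<Rightarrow> real"
  assumes f: "adapted n f" and g: "integrable (path_measure K s) g"
  shows "integrable (path_measure K s) (\<lambda>\<omega>. f \<omega> * g \<omega>)"
proof -
  have "integrable (path_measure K s)
      (\<lambda>\<omega>. \<Sum>x\<in>prefixes n. f x * (indicator (cylinder n x) \<omega> *\<^sub>R g \<omega>))"
    using g by (intro Bochner_Integration.integrable_sum integrable_mult_right integrable_mult_indicator) auto
  also have "(\<lambda>\<omega>. \<Sum>x\<in>prefixes n. f x * (indicator (cylinder n x) \<omega> *\<^sub>R g \<omega>)) = (\<lambda>\<omega>. f \<omega> * g \<omega>)"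
  proof
    show "(\<Sum>x\<in>prefixes n. f x * (indicator (cylinder n x) \<omega> *\<^sub>R g \<omega>)) = f \<omega> * g \<omega>" for \<omega>
      by (simp add: adapted_eq_sum_cylinders[OF f, of \<omega>] sum_distrib_right mult.assoc)
  qed
  finally show ?thesis .
qed

lemma integrable_adapted:
  fixes f :: "(nat \<Rightarrow> 's::finite) \<Rightarrow> real"
  assumes "adapted n f"
  shows "integrable (path_measure K s) f"
proof -
  interpret prob_space "path_measure K s"
    by (rule prob_space_path_measure)
  show ?thesis
    using integrable_adapted_mult[OF assms, of K s "\<lambda>_. 1"] by simp
qed

lemma integral_adapted_mult:
  fixes f :: "(nat \<Rightarrow> 's::finite) \<Rightarrow> real"
  assumes f: "adapted n f" and g: "integrable (path_measure K s) g"
  shows "(\<integral>\<omega>. f \<omega> * g \<omega> \<partial>path_measure K s) =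
    (\<Sum>x\<in>prefixes n. f x * (\<integral>\<omega>. indicator (cylinder n x) \<omega> * g \<omega> \<partial>path_measure K s))"
proof -
  have i: "integrable (path_measure K s) (\<lambda>\<omega>. indicator (cylinder n x) \<omega> * g \<omega>)" for x
    using integrable_mult_indicator[OF _ g, of "cylinder n x"] by simp
  have "f \<omega> * g \<omega> = (\<Sum>x\<in>prefixes n. f x * (indicator (cylinder n x) \<omega> * g \<omega>))" for \<omega>
    by (subst adapted_eq_sum_cylinders[OF f, of \<omega>]) (simp add: sum_distrib_right mult.assoc)
  then have "(\<integral>\<omega>. f \<omega> * g \<omega> \<partial>path_measure K s) =
      (\<integral>\<omega>. (\<Sum>x\<in>prefixes n. f x * (indicator (cylinder n x) \<omega> * g \<omega>)) \<partial>path_measure K s)"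
    by (intro Bochner_Integration.integral_cong) auto
  also have "\<dots> = (\<Sum>x\<in>prefixes n. f x * (\<integral>\<omega>. indicator (cylinder n x) \<omega> * g \<omega> \<partial>path_measure K s))"
    by (subst Bochner_Integration.integral_sum) (auto intro: i)
  finally show ?thesis .
qed

lemma integral_adapted:
  fixes f :: "(nat \<Rightarrow> 's::finite) \<Rightarrow> real"
  assumes "adapted n f"
  shows "(\<integral>\<omega>. f \<omega> \<partial>path_measure K s) = (\<Sum>x\<in>prefixes n. f x * cylinder_prob K s n x)"
proof -
  interpret prob_space "path_measure K s"
    by (rule prob_space_path_measure)
  show ?thesis
    using integral_adapted_mult[OF assms, of K s "\<lambda>_. 1"] by (simp add: measure_cylinder)
qed

text \<open>
  The Markov property for one step. By linearity it suffices to consider a cylinder, and prolonging a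
  cylinder by the state \<open>r\<close> multiplies its probability by a transition probability.
\<close>

lemma integral_one_step:
  fixes f :: "(nat \<Rightarrow> 's::finite) \<Rightarrow> real"
  assumes f: "adapted n f"
  shows "(\<integral>\<omega>. f \<omega> * \<phi> (\<omega> n) (\<omega> (Suc n)) \<partial>path_measure K s) =
    (\<integral>\<omega>. f \<omega> * (\<Sum>r\<in>UNIV. pmf (K (\<omega> n)) r * \<phi> (\<omega> n) r) \<partial>path_measure K s)"
proof -
  have step: "(\<integral>\<omega>. indicator (cylinder n x) \<omega> * \<phi> (\<omega> n) (\<omega> (Suc n)) \<partial>path_measure K s) =
      cylinder_prob K s n x * (\<Sum>r\<in>UNIV. pmf (K (x n)) r * \<phi> (x n) r)" for x
  proof -
    have "indicator (cylinder n x) \<omega> * \<phi> (\<omega> n) (\<omega> (Suc n)) =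
        (\<Sum>r\<in>UNIV. \<phi> (x n) r * indicator (cylinder (Suc n) (x(Suc n := r))) \<omega>)" for \<omega>
    proof -
      have "(\<Sum>r\<in>UNIV. \<phi> (x n) r * indicator (cylinder (Suc n) (x(Suc n := r))) \<omega>) =
          (\<Sum>r\<in>UNIV. if r = \<omega> (Suc n) then indicator (cylinder n x) \<omega> * \<phi> (\<omega> n) r else 0)"
        by (intro sum.cong) (auto simp: cylinder_def indicator_def le_Suc_eq)
      then show ?thesis
        by simp
    qed
    then have "(\<integral>\<omega>. indicator (cylinder n x) \<omega> * \<phi> (\<omega> n) (\<omega> (Suc n)) \<partial>path_measure K s) =
        (\<integral>\<omega>. (\<Sum>r\<in>UNIV. \<phi> (x n) r * indicator (cylinder (Suc n) (x(Suc n := r))) \<omega>) \<partial>path_measure K s)"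
      by simp
    also have "\<dots> = (\<Sum>r\<in>UNIV. \<phi> (x n) r * cylinder_prob K s (Suc n) (x(Suc n := r)))"
    proof -
      interpret prob_space "path_measure K s"
        by (rule prob_space_path_measure)
      show ?thesis
        by (subst Bochner_Integration.integral_sum)
          (auto simp: measure_cylinder integrable_real_indicator less_top[symmetric] intro!: integrable_mult_right)
    qed
    also have "\<dots> = cylinder_prob K s n x * (\<Sum>r\<in>UNIV. pmf (K (x n)) r * \<phi> (x n) r)"
      by (auto simp: cylinder_prob_def sum_distrib_left intro!: sum.cong prod.cong)
    finally show ?thesis .
  qed
  have "adapted (Suc n) (\<lambda>\<omega>. \<phi> (\<omega> n) (\<omega> (Suc n)))"
    by (auto simp: adapted_def)
  then have "(\<integral>\<omega>. f \<omega> * \<phi> (\<omega> n) (\<omega> (Suc n)) \<partial>path_measure K s) =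
      (\<Sum>x\<in>prefixes n. f x * (cylinder_prob K s n x * (\<Sum>r\<in>UNIV. pmf (K (x n)) r * \<phi> (x n) r)))"
    by (subst integral_adapted_mult[OF f]) (auto intro: integrable_adapted simp: step)
  also have "\<dots> = (\<integral>\<omega>. f \<omega> * (\<Sum>r\<in>UNIV. pmf (K (\<omega> n)) r * \<phi> (\<omega> n) r) \<partial>path_measure K s)"
    by (subst integral_adapted[OF adapted_mult[OF f adapted_coordinate[of n n]]]) (auto simp: mult_ac)
  finally show ?thesis .
qed

lemma AE_initial_state: "AE \<omega> in path_measure K (s::'s::finite). \<omega> 0 = s"
proof -
  interpret prob_space "path_measure K s"
    by (rule prob_space_path_measure)
  have "prob (cylinder 0 (\<lambda>_. s)) = 1"
    by (simp add: measure_cylinder cylinder_prob_def)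
  then have "AE \<omega> in path_measure K s. \<omega> \<in> cylinder 0 (\<lambda>_. s)"
    by (rule AE_prob_1)
  then show ?thesis
    by (simp add: cylinder_def)
qed

text \<open>
  By induction on \<open>j\<close>: one step replaces \<open>\<psi>\<close> by its average over the transition distribution, both
  for the original chain and for the chain restarted in \<open>z\<close>. Therefore \<open>\<psi>\<close> must be arbitrary in the induction.
\<close>

lemma markov_property:
  fixes f :: "(nat \<Rightarrow> 's::finite) \<Rightarrow> real"
  assumes f: "adapted k f"
  shows "(\<integral>\<omega>. f \<omega> * indicator {z} (\<omega> k) * \<psi> (\<omega> (k + j)) \<partial>path_measure K s) =
    (\<integral>\<omega>. f \<omega> * indicator {z} (\<omega> k) \<partial>path_measure K s) * (\<integral>\<omega>. \<psi> (\<omega> j) \<partial>path_measure K z)"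
proof (induction j arbitrary: \<psi>)
  case 0
  interpret Z: prob_space "path_measure K z"
    by (rule prob_space_path_measure)
  have [measurable]: "(\<lambda>\<omega>. \<psi> (\<omega> 0)) \<in> borel_measurable path_space"
    by measurable
  have "(\<integral>\<omega>. \<psi> (\<omega> 0) \<partial>path_measure K z) = (\<integral>\<omega>. \<psi> z \<partial>path_measure K z)"
    by (intro integral_cong_AE) (use AE_initial_state[where K=K and s=z] in auto)
  then have init: "(\<integral>\<omega>. \<psi> (\<omega> 0) \<partial>path_measure K z) = \<psi> z"
    by (simp add: Z.prob_space[simplified])
  have "(\<integral>\<omega>. f \<omega> * indicator {z} (\<omega> k) * \<psi> (\<omega> k) \<partial>path_measure K s) =
      (\<integral>\<omega>. f \<omega> * indicator {z} (\<omega> k) * \<psi> z \<partial>path_measure K s)"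
    by (intro Bochner_Integration.integral_cong) (auto simp: indicator_def)
  then show ?case
    by (simp add: init)
next
  case (Suc j)
  define \<psi>' where "\<psi>' y = (\<Sum>r\<in>UNIV. pmf (K y) r * \<psi> r)" for y
  have "adapted (k + j) (\<lambda>\<omega>. f \<omega> * indicator {z} (\<omega> k))"
    by (intro adapted_mult adapted_mono[OF f] adapted_coordinate) auto
  then have "(\<integral>\<omega>. f \<omega> * indicator {z} (\<omega> k) * \<psi> (\<omega> (k + Suc j)) \<partial>path_measure K s) =
      (\<integral>\<omega>. f \<omega> * indicator {z} (\<omega> k) * \<psi>' (\<omega> (k + j)) \<partial>path_measure K s)"
    using integral_one_step[where n="k + j" and \<phi>="\<lambda>_. \<psi>"] by (simp add: \<psi>'_def)
  also have "\<dots> = (\<integral>\<omega>. f \<omega> * indicator {z} (\<omega> k) \<partial>path_measure K s) * (\<integral>\<omega>. \<psi>' (\<omega> j) \<partial>path_measure K z)"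
    by (rule Suc.IH)
  also have "(\<integral>\<omega>. \<psi>' (\<omega> j) \<partial>path_measure K z) = (\<integral>\<omega>. \<psi> (\<omega> (Suc j)) \<partial>path_measure K z)"
    using integral_one_step[OF adapted_const[of j 1], where \<phi>="\<lambda>_. \<psi>" and K=K and s=z] by (simp add: \<psi>'_def)
  finally show ?case .
qed

section \<open>Change of measure between two chains\<close>

text \<open>Here \<open>\<phi> y r\<close> stands for the ratio of the probabilities of the transition from \<open>y\<close> to \<open>r\<close>.\<close>

definition likelihood_ratio :: "('s \<Rightarrow> 's \<Rightarrow> real) \<Rightarrow> nat \<Rightarrow> (nat \<Rightarrow> 's) \<Rightarrow> real"
  where "likelihood_ratio \<phi> n \<omega> = (\<Prod>t<n. \<phi> (\<omega> t) (\<omega> (Suc t)))"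

lemma adapted_likelihood_ratio: "n \<le> m \<Longrightarrow> adapted m (likelihood_ratio \<phi> n)"
  by (auto simp: adapted_def likelihood_ratio_def intro!: prod.cong)

lemma integral_change_of_measure:
  fixes K K' :: "'s::finite \<Rightarrow> 's pmf"
  assumes K': "\<And>y r. pmf (K' y) r = pmf (K y) r * \<phi> y r"
    and f: "adapted n f"
  shows "(\<integral>\<omega>. f \<omega> \<partial>path_measure K' s) = (\<integral>\<omega>. f \<omega> * likelihood_ratio \<phi> n \<omega> \<partial>path_measure K s)"
  unfolding integral_adapted[OF f] integral_adapted[OF adapted_mult[OF f adapted_likelihood_ratio[OF order_refl]]]
  by (simp add: cylinder_prob_def K' likelihood_ratio_def prod.distrib mult_ac)

definition not_visited_from :: "'s \<Rightarrow> nat \<Rightarrow> (nat \<Rightarrow> 's) set"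
  where "not_visited_from w n = {\<omega>. \<forall>t\<ge>n. \<omega> t \<noteq> w}"

lemma sets_not_visited_from [measurable]: "not_visited_from (w::'s::finite) n \<in> sets path_space"
proof -
  have "not_visited_from w n = {\<omega> \<in> space path_space. \<forall>t\<ge>n. \<omega> t \<noteq> w}"
    by (auto simp: not_visited_from_def space_PiM)
  also have "\<dots> \<in> sets path_space"
    by measurable
  finally show ?thesis .
qed

text \<open>
  The two laws need not have a density on the whole path space, but they have one on the event that \<open>w\<close>
  is not visited from time \<open>n\<close> on, because there the likelihood ratio stays constant after time
  \<open>n\<close>. It suffices to compare the measures on cylinders. For these, the event that \<open>w\<close> is not visited
  between the times \<open>n\<close> and \<open>N\<close> depends on finitely many states, so that the elementary change of measure applies;
  then \<open>N\<close> tends to infinity.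
\<close>

lemma density_not_visited_from:
  fixes K K' :: "'s::finite \<Rightarrow> 's pmf"
  assumes K': "\<And>y r. pmf (K' y) r = pmf (K y) r * \<phi> y r"
    and nonneg: "\<And>y r. 0 \<le> \<phi> y r"
    and \<phi>: "\<And>y r. y \<noteq> w \<Longrightarrow> \<phi> y r = 1"
  shows "density (path_measure K' s) (\<lambda>\<omega>. ennreal (indicator (not_visited_from w n) \<omega>)) =
    density (path_measure K s) (\<lambda>\<omega>. ennreal (indicator (not_visited_from w n) \<omega> * likelihood_ratio \<phi> n \<omega>))"
    (is "?Q = ?P")
proof (rule measure_eqI_PiM_infinite[where I=UNIV and M="\<lambda>_. count_space UNIV"])
  interpret P: prob_space "path_measure K s"
    by (rule prob_space_path_measure)
  interpret Q: prob_space "path_measure K' s"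
    by (rule prob_space_path_measure)
  have lr_nonneg: "0 \<le> likelihood_ratio \<phi> n \<omega>" for \<omega>
    unfolding likelihood_ratio_def by (intro prod_nonneg nonneg ballI)
  have lr[measurable]: "likelihood_ratio \<phi> n \<in> borel_measurable path_space"
    by (rule adapted_measurable[OF adapted_likelihood_ratio[OF order_refl]])
  have lr_int: "integrable (path_measure K s) (likelihood_ratio \<phi> n)"
    by (rule integrable_adapted[OF adapted_likelihood_ratio[OF order_refl]])
  show "sets ?Q = sets path_space" "sets ?P = sets path_space"
    by simp_all
  show "finite_measure ?Q"
  proof (rule finite_measureI)
    have [simp]: "UNIV \<in> sets (path_space :: (nat \<Rightarrow> 's) measure)"
      using sets.top[of "path_space :: (nat \<Rightarrow> 's) measure"] by (simp add: space_PiM)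
    have "emeasure ?Q (space ?Q) \<le> (\<integral>\<^sup>+\<omega>. 1 \<partial>path_measure K' s)"
      by (subst emeasure_density) (simp_all del: nn_integral_const add: nn_integral_mono indicator_def)
    also have "\<dots> = 1"
      using Q.emeasure_space_1 by simp
    finally show "emeasure ?Q (space ?Q) \<noteq> \<infinity>"
      by (auto simp: top_unique)
  qed
  fix A :: "nat \<Rightarrow> 's set" and J :: "nat set"
  assume J: "finite J"
  define E where "E = prod_emb UNIV (\<lambda>_. count_space UNIV) J (Pi\<^sub>E J A)"
  obtain m where m: "\<And>i. i \<in> J \<Longrightarrow> i \<le> m"
    using J unfolding finite_nat_set_iff_bounded_le by auto
  have E_eq: "E = {\<omega>. \<forall>i\<in>J. \<omega> i \<in> A i}"
    by (auto simp: E_def prod_emb_def PiE_iff)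
  have [measurable]: "E \<in> sets path_space"
    unfolding E_def using J by (intro sets_PiM_I) auto
  define F where "F N = {\<omega>. \<forall>t\<in>{n..<N}. \<omega> t \<noteq> w}" for N
  have F_adapted: "adapted N (indicator (F N))" for N
    by (auto simp: adapted_def F_def indicator_def)
  have [measurable]: "F N \<in> sets path_space" for N
  proof -
    have "F N = {\<omega> \<in> space path_space. \<forall>t\<in>{n..<N}. \<omega> t \<noteq> w}"
      by (auto simp: F_def space_PiM)
    also have "\<dots> \<in> sets path_space"
      by measurable
    finally show ?thesis .
  qed
  have E_adapted: "adapted N (indicator E)" if "m \<le> N" for N
    unfolding adapted_def
  proof (intro allI impI)
    fix \<omega> \<omega>' :: "nat \<Rightarrow> 's"
    assume "\<forall>i\<le>N. \<omega> i = \<omega>' i"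
    then have "\<omega> i = \<omega>' i" if "i \<in> J" for i
      using m[OF that] \<open>m \<le> N\<close> by simp
    then show "indicator E \<omega> = (indicator E \<omega>' :: real)"
      by (simp add: E_eq indicator_def)
  qed
  have F_lim: "(\<lambda>N. indicator (F N) \<omega> :: real) \<longlonglongrightarrow> indicator (not_visited_from w n) \<omega>" for \<omega>
  proof (rule tendsto_eventually)
    show "\<forall>\<^sub>F N in sequentially. indicator (F N) \<omega> = (indicator (not_visited_from w n) \<omega> :: real)"
    proof (cases "\<omega> \<in> not_visited_from w n")
      case True
      then show ?thesis
        by (intro always_eventually) (auto simp: F_def not_visited_from_def)
    next
      case False
      then obtain t where t: "t \<ge> n" "\<omega> t = w"
        by (auto simp: not_visited_from_def)
      show ?thesis
        using eventually_ge_at_top[of "Suc t"]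
        by eventually_elim (use t False in \<open>auto simp: F_def indicator_def\<close>)
    qed
  qed
  have lr_F: "indicator (F N) \<omega> * likelihood_ratio \<phi> N \<omega> = indicator (F N) \<omega> * likelihood_ratio \<phi> n \<omega>"
    if "n \<le> N" for N \<omega>
  proof (cases "\<omega> \<in> F N")
    case True
    have "likelihood_ratio \<phi> N \<omega> =
        (\<Prod>t\<in>{..<n}. \<phi> (\<omega> t) (\<omega> (Suc t))) * (\<Prod>t\<in>{n..<N}. \<phi> (\<omega> t) (\<omega> (Suc t)))"
      unfolding likelihood_ratio_def using that
      by (subst prod.union_disjoint[symmetric]) (auto intro!: prod.cong)
    also have "(\<Prod>t\<in>{n..<N}. \<phi> (\<omega> t) (\<omega> (Suc t))) = 1"
      by (intro prod.neutral) (use True in \<open>auto simp: F_def \<phi>\<close>)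
    finally show ?thesis
      by (simp add: likelihood_ratio_def)
  qed simp
  have "(\<lambda>N. \<integral>\<omega>. indicat_real E \<omega> * indicator (F N) \<omega> \<partial>path_measure K' s) \<longlonglongrightarrow>
      (\<integral>\<omega>. indicator E \<omega> * indicator (not_visited_from w n) \<omega> \<partial>path_measure K' s)"
    by (rule integral_dominated_convergence[where w="\<lambda>_. 1"])
      (auto intro!: tendsto_mult F_lim simp: abs_mult indicator_le_1 mult_le_one)
  moreover have "\<forall>\<^sub>F N in sequentially. (\<integral>\<omega>. indicat_real E \<omega> * indicator (F N) \<omega> \<partial>path_measure K' s) =
      (\<integral>\<omega>. indicator E \<omega> * indicator (F N) \<omega> * likelihood_ratio \<phi> n \<omega> \<partial>path_measure K s)"
    using eventually_ge_at_top[of "max m n"]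
  proof eventually_elim
    case (elim N)
    have "(\<integral>\<omega>. indicat_real E \<omega> * indicator (F N) \<omega> \<partial>path_measure K' s) =
        (\<integral>\<omega>. indicator E \<omega> * indicator (F N) \<omega> * likelihood_ratio \<phi> N \<omega> \<partial>path_measure K s)"
      by (rule integral_change_of_measure[OF K' adapted_mult[OF E_adapted F_adapted]]) (use elim in auto)
    also have "\<dots> = (\<integral>\<omega>. indicator E \<omega> * indicator (F N) \<omega> * likelihood_ratio \<phi> n \<omega> \<partial>path_measure K s)"
      using elim by (simp only: mult.assoc lr_F[of N])
    finally show ?case .
  qed
  ultimately have "(\<lambda>N. \<integral>\<omega>. indicator E \<omega> * indicator (F N) \<omega> * likelihood_ratio \<phi> n \<omega> \<partial>path_measure K s)
      \<longlonglongrightarrow> (\<integral>\<omega>. indicator E \<omega> * indicator (not_visited_from w n) \<omega> \<partial>path_measure K' s)"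
    by (rule Lim_transform_eventually)
  moreover have "(\<lambda>N. \<integral>\<omega>. indicator E \<omega> * indicator (F N) \<omega> * likelihood_ratio \<phi> n \<omega> \<partial>path_measure K s)
      \<longlonglongrightarrow> (\<integral>\<omega>. indicator E \<omega> * indicator (not_visited_from w n) \<omega> * likelihood_ratio \<phi> n \<omega> \<partial>path_measure K s)"
    by (rule integral_dominated_convergence[where w="likelihood_ratio \<phi> n"])
      (auto intro!: tendsto_mult F_lim lr_int mult_left_le_one_le mult_le_one
        simp: abs_mult lr_nonneg indicator_le_1)
  ultimately have eq: "(\<integral>\<omega>. indicat_real E \<omega> * indicator (not_visited_from w n) \<omega> \<partial>path_measure K' s) =
      (\<integral>\<omega>. indicator E \<omega> * indicator (not_visited_from w n) \<omega> * likelihood_ratio \<phi> n \<omega> \<partial>path_measure K s)"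
    by (rule LIMSEQ_unique)
  have "emeasure ?Q E = (\<integral>\<^sup>+\<omega>. ennreal (indicator E \<omega> * indicator (not_visited_from w n) \<omega>) \<partial>path_measure K' s)"
    by (subst emeasure_density) (auto intro!: nn_integral_cong simp: indicator_def)
  also have "\<dots> = ennreal (\<integral>\<omega>. indicator E \<omega> * indicator (not_visited_from w n) \<omega> \<partial>path_measure K' s)"
    by (rule nn_integral_eq_integral)
      (auto intro!: Q.integrable_const_bound[of _ 1] simp: indicator_def)
  also have "\<dots> = (\<integral>\<^sup>+\<omega>. ennreal (indicator E \<omega> * indicator (not_visited_from w n) \<omega> * likelihood_ratio \<phi> n \<omega>)
      \<partial>path_measure K s)"
    unfolding eq
    by (rule nn_integral_eq_integral[symmetric])
      (auto intro!: Bochner_Integration.integrable_bound[OF lr_int] simp: indicator_def lr_nonneg)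
  also have "\<dots> = emeasure ?P E"
    by (subst emeasure_density) (auto intro!: nn_integral_cong simp: indicator_def)
  finally show "emeasure ?Q (prod_emb UNIV (\<lambda>_. count_space UNIV) J (Pi\<^sub>E J A)) =
      emeasure ?P (prod_emb UNIV (\<lambda>_. count_space UNIV) J (Pi\<^sub>E J A))"
    unfolding E_def .
qed

section \<open>The Hammersley-Chapman-Robbins inequality\<close>

lemma integral_Cauchy_Schwarz:
  fixes f g :: "'a \<Rightarrow> real"
  assumes [measurable]: "f \<in> borel_measurable M" "g \<in> borel_measurable M"
    and f: "integrable M (\<lambda>x. (f x)\<^sup>2)" and g: "integrable M (\<lambda>x. (g x)\<^sup>2)"
  shows "integrable M (\<lambda>x. f x * g x)"
    and "(\<integral>x. f x * g x \<partial>M)\<^sup>2 \<le> (\<integral>x. (f x)\<^sup>2 \<partial>M) * (\<integral>x. (g x)\<^sup>2 \<partial>M)"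
proof -
  have "(\<integral>\<^sup>+x. ennreal \<bar>f x\<bar> * ennreal \<bar>g x\<bar> \<partial>M)\<^sup>2 \<le>
      (\<integral>\<^sup>+x. ennreal \<bar>f x\<bar> ^ 2 \<partial>M) * (\<integral>\<^sup>+x. ennreal \<bar>g x\<bar> ^ 2 \<partial>M)"
    by (rule Cauchy_Schwarz_nn_integral) simp_all
  also have "(\<lambda>x. ennreal \<bar>f x\<bar> * ennreal \<bar>g x\<bar>) = (\<lambda>x. ennreal \<bar>f x * g x\<bar>)"
    by (simp add: abs_mult ennreal_mult)
  also have "(\<lambda>x. ennreal \<bar>f x\<bar> ^ 2) = (\<lambda>x. ennreal ((f x)\<^sup>2))"
    by (simp add: ennreal_power)
  also have "(\<lambda>x. ennreal \<bar>g x\<bar> ^ 2) = (\<lambda>x. ennreal ((g x)\<^sup>2))"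
    by (simp add: ennreal_power)
  also have "(\<integral>\<^sup>+x. ennreal ((f x)\<^sup>2) \<partial>M) = ennreal (\<integral>x. (f x)\<^sup>2 \<partial>M)"
    by (rule nn_integral_eq_integral[OF f]) simp
  also have "(\<integral>\<^sup>+x. ennreal ((g x)\<^sup>2) \<partial>M) = ennreal (\<integral>x. (g x)\<^sup>2 \<partial>M)"
    by (rule nn_integral_eq_integral[OF g]) simp
  finally have le: "(\<integral>\<^sup>+x. ennreal \<bar>f x * g x\<bar> \<partial>M)\<^sup>2 \<le> ennreal ((\<integral>x. (f x)\<^sup>2 \<partial>M) * (\<integral>x. (g x)\<^sup>2 \<partial>M))"
    by (simp add: ennreal_mult)
  have "(\<integral>\<^sup>+x. ennreal \<bar>f x * g x\<bar> \<partial>M)\<^sup>2 < \<top>"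
    by (rule le_less_trans[OF le]) simp
  then have "(\<integral>\<^sup>+x. ennreal \<bar>f x * g x\<bar> \<partial>M) < \<infinity>"
    by (simp add: power_less_top_ennreal)
  then show int: "integrable M (\<lambda>x. f x * g x)"
    by (intro integrableI_bounded) simp_all
  have "(\<integral>\<^sup>+x. ennreal \<bar>f x * g x\<bar> \<partial>M) = ennreal (\<integral>x. \<bar>f x * g x\<bar> \<partial>M)"
    by (rule nn_integral_eq_integral) (use int in auto)
  with le have "ennreal ((\<integral>x. \<bar>f x * g x\<bar> \<partial>M)\<^sup>2) \<le> ennreal ((\<integral>x. (f x)\<^sup>2 \<partial>M) * (\<integral>x. (g x)\<^sup>2 \<partial>M))"
    by (simp add: ennreal_power)
  then have "(\<integral>x. \<bar>f x * g x\<bar> \<partial>M)\<^sup>2 \<le> (\<integral>x. (f x)\<^sup>2 \<partial>M) * (\<integral>x. (g x)\<^sup>2 \<partial>M)"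
    by (subst (asm) ennreal_le_iff) auto
  moreover have "(\<integral>x. f x * g x \<partial>M)\<^sup>2 \<le> (\<integral>x. \<bar>f x * g x\<bar> \<partial>M)\<^sup>2"
    using integral_abs_bound[of M "\<lambda>x. f x * g x"] by (intro abs_le_square_iff[THEN iffD1]) simp
  ultimately show "(\<integral>x. f x * g x \<partial>M)\<^sup>2 \<le> (\<integral>x. (f x)\<^sup>2 \<partial>M) * (\<integral>x. (g x)\<^sup>2 \<partial>M)"
    by simp
qed

definition visit_prob :: "('s \<Rightarrow> 's pmf) \<Rightarrow> 's \<Rightarrow> 's \<Rightarrow> nat \<Rightarrow> real"
  where "visit_prob K s w n = (\<integral>\<omega>. indicator {w} (\<omega> n) \<partial>path_measure K s)"

lemma visit_prob_nonneg: "0 \<le> visit_prob K s w n"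
  unfolding visit_prob_def by (rule integral_nonneg_AE) simp

lemma sets_visit: "{\<omega>. \<omega> n = w} \<in> sets (path_space :: (nat \<Rightarrow> 's) measure)"
proof -
  have "{\<omega>. \<omega> n = w} = {\<omega> \<in> space (path_space :: (nat \<Rightarrow> 's) measure). \<omega> n = w}"
    by (auto simp: space_PiM)
  also have "\<dots> \<in> sets path_space"
    by measurable
  finally show ?thesis .
qed

lemma visit_prob_eq_measure: "visit_prob K s w n = measure (path_measure K s) {\<omega>. \<omega> n = w}"
proof -
  interpret prob_space "path_measure K s"
    by (rule prob_space_path_measure)
  have "visit_prob K s w n = (\<integral>\<omega>. indicator {\<omega>. \<omega> n = w} \<omega> \<partial>path_measure K s)"
    unfolding visit_prob_def by (rule Bochner_Integration.integral_cong) (auto simp: indicator_def)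
  then show ?thesis
    using sets_visit by simp
qed

text \<open>The lemma of Borel and Cantelli: if the expected number of visits is finite, there is almost surely a last one.\<close>

lemma AE_finally_not_visited:
  assumes "summable (visit_prob K s w)"
  shows "AE \<omega> in path_measure K s. (\<lambda>n. indicat_real (not_visited_from w n) \<omega>) \<longlonglongrightarrow> 1"
proof -
  interpret prob_space "path_measure K s"
    by (rule prob_space_path_measure)
  have "AE \<omega> in path_measure K s. \<forall>\<^sub>F n in sequentially. \<omega> \<in> space (path_measure K s) - {\<omega>. \<omega> n = w}"
    by (rule borel_cantelli_AE1)
      (use assms sets_visit in \<open>auto simp: visit_prob_eq_measure[abs_def] less_top[symmetric]\<close>)
  then show ?thesis
  proof eventually_elim
    case (elim \<omega>)
    then obtain N where N: "\<And>n. n \<ge> N \<Longrightarrow> \<omega> n \<noteq> w"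
      by (auto simp: eventually_sequentially)
    have "\<forall>\<^sub>F n in sequentially. indicat_real (not_visited_from w n) \<omega> = 1"
      using eventually_ge_at_top[of N]
      by eventually_elim (use N in \<open>simp add: not_visited_from_def indicator_def\<close>)
    then show ?case
      by (rule tendsto_eventually)
  qed
qed

lemma integral_not_visited_tendsto:
  fixes g :: "(nat \<Rightarrow> 's::finite) \<Rightarrow> real"
  assumes "summable (visit_prob K s w)" and g: "integrable (path_measure K s) g"
  shows "(\<lambda>n. \<integral>\<omega>. indicator (not_visited_from w n) \<omega> * g \<omega> \<partial>path_measure K s)
    \<longlonglongrightarrow> (\<integral>\<omega>. g \<omega> \<partial>path_measure K s)"
proof (rule integral_dominated_convergence[where w="\<lambda>\<omega>. \<bar>g \<omega>\<bar>"])
  show "AE \<omega> in path_measure K s. (\<lambda>n. indicator (not_visited_from w n) \<omega> * g \<omega>) \<longlonglongrightarrow> g \<omega>"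
    using AE_finally_not_visited[OF assms(1)]
    by eventually_elim (auto intro: tendsto_eq_intros)
qed (use g in \<open>auto simp: indicator_def\<close>)

text \<open>
  On the paths that avoid \<open>w\<close> from time \<open>n\<close> on, the two means of \<open>g\<close> differ by the integral of
  \<open>g * (likelihood_ratio \<phi> n - 1)\<close>, to which Cauchy-Schwarz applies. The bound does not depend on
  \<open>n\<close>, and these paths exhaust the path space under both laws.
\<close>

lemma chapman_robbins:
  fixes K K' :: "'s::finite \<Rightarrow> 's pmf"
  assumes K': "\<And>y r. pmf (K' y) r = pmf (K y) r * \<phi> y r"
    and nonneg: "\<And>y r. 0 \<le> \<phi> y r"
    and \<phi>: "\<And>y r. y \<noteq> w \<Longrightarrow> \<phi> y r = 1"
    and transient: "summable (visit_prob K s w)" "summable (visit_prob K' s w)"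
    and C: "\<And>n. (\<integral>\<omega>. (likelihood_ratio \<phi> n \<omega> - 1)\<^sup>2 \<partial>path_measure K s) \<le> C"
    and [measurable]: "g \<in> borel_measurable path_space"
    and g2: "integrable (path_measure K s) (\<lambda>\<omega>. (g \<omega>)\<^sup>2)"
    and g': "integrable (path_measure K' s) g"
  shows "((\<integral>\<omega>. g \<omega> \<partial>path_measure K' s) - (\<integral>\<omega>. g \<omega> \<partial>path_measure K s))\<^sup>2
    \<le> (\<integral>\<omega>. (g \<omega>)\<^sup>2 \<partial>path_measure K s) * C"
proof -
  let ?P = "path_measure K s" and ?Q = "path_measure K' s"
  interpret P: prob_space ?P
    by (rule prob_space_path_measure)
  have g: "integrable ?P g"
    by (rule P.square_integrable_imp_integrable[OF _ g2]) simp
  let ?B = "\<lambda>n \<omega>. indicat_real (not_visited_from w n) \<omega>" and ?L = "likelihood_ratio \<phi>"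
  have lr[measurable]: "?L n \<in> borel_measurable path_space" for n
    by (rule adapted_measurable[OF adapted_likelihood_ratio[OF order_refl]])
  have lr_nonneg: "0 \<le> ?L n \<omega>" for n \<omega>
    unfolding likelihood_ratio_def by (intro prod_nonneg nonneg ballI)
  have sq_int: "integrable ?P (\<lambda>\<omega>. (?L n \<omega> - 1)\<^sup>2)" for n
  proof (rule integrable_adapted)
    show "adapted n (\<lambda>\<omega>. (?L n \<omega> - 1)\<^sup>2)"
      using adapted_likelihood_ratio[OF order_refl, of n \<phi>] unfolding adapted_def by metis
  qed
  have bound: "((\<integral>\<omega>. ?B n \<omega> * g \<omega> \<partial>?Q) - (\<integral>\<omega>. ?B n \<omega> * g \<omega> \<partial>?P))\<^sup>2 \<le> (\<integral>\<omega>. (g \<omega>)\<^sup>2 \<partial>?P) * C" for n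
  proof -
    have Bg2: "integrable ?P (\<lambda>\<omega>. (?B n \<omega> * g \<omega>)\<^sup>2)"
    proof -
      have "(\<lambda>\<omega>. (?B n \<omega> * g \<omega>)\<^sup>2) = (\<lambda>\<omega>. ?B n \<omega> *\<^sub>R (g \<omega>)\<^sup>2)"
        by (auto simp: fun_eq_iff indicator_def)
      then show ?thesis
        using integrable_mult_indicator[OF _ g2, of "not_visited_from w n"] by simp
    qed
    have Bg: "integrable ?P (\<lambda>\<omega>. ?B n \<omega> * g \<omega>)"
      using integrable_mult_indicator[OF _ g, of "not_visited_from w n"] by simp
    have int: "integrable ?P (\<lambda>\<omega>. (?B n \<omega> * g \<omega>) * (?L n \<omega> - 1))"
      by (rule integral_Cauchy_Schwarz(1)[OF _ _ Bg2 sq_int]) measurable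
    have "(\<integral>\<omega>. ?B n \<omega> * g \<omega> \<partial>?Q) = (\<integral>\<omega>. g \<omega> \<partial>density ?Q (\<lambda>\<omega>. ennreal (?B n \<omega>)))"
      by (subst integral_density) auto
    also have "\<dots> = (\<integral>\<omega>. g \<omega> \<partial>density ?P (\<lambda>\<omega>. ennreal (?B n \<omega> * ?L n \<omega>)))"
      by (subst density_not_visited_from[OF K' nonneg \<phi>]) auto
    also have "\<dots> = (\<integral>\<omega>. ?B n \<omega> * ?L n \<omega> * g \<omega> \<partial>?P)"
      by (subst integral_density) (auto simp: lr_nonneg)
    also have "\<dots> = (\<integral>\<omega>. (?B n \<omega> * g \<omega>) * (?L n \<omega> - 1) + ?B n \<omega> * g \<omega> \<partial>?P)"
      by (simp add: algebra_simps)
    also have "\<dots> = (\<integral>\<omega>. (?B n \<omega> * g \<omega>) * (?L n \<omega> - 1) \<partial>?P) + (\<integral>\<omega>. ?B n \<omega> * g \<omega> \<partial>?P)"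
      by (rule Bochner_Integration.integral_add[OF int Bg])
    finally have "((\<integral>\<omega>. ?B n \<omega> * g \<omega> \<partial>?Q) - (\<integral>\<omega>. ?B n \<omega> * g \<omega> \<partial>?P))\<^sup>2 =
        (\<integral>\<omega>. (?B n \<omega> * g \<omega>) * (?L n \<omega> - 1) \<partial>?P)\<^sup>2"
      by simp
    also have "\<dots> \<le> (\<integral>\<omega>. (?B n \<omega> * g \<omega>)\<^sup>2 \<partial>?P) * (\<integral>\<omega>. (?L n \<omega> - 1)\<^sup>2 \<partial>?P)"
      by (rule integral_Cauchy_Schwarz(2)[OF _ _ Bg2 sq_int]) measurable
    also have "\<dots> \<le> (\<integral>\<omega>. (g \<omega>)\<^sup>2 \<partial>?P) * C"
      by (intro mult_mono C integral_mono Bg2 g2) (auto simp: indicator_def integral_nonneg_AE)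
    finally show ?thesis .
  qed
  have "(\<lambda>n. ((\<integral>\<omega>. ?B n \<omega> * g \<omega> \<partial>?Q) - (\<integral>\<omega>. ?B n \<omega> * g \<omega> \<partial>?P))\<^sup>2)
      \<longlonglongrightarrow> ((\<integral>\<omega>. g \<omega> \<partial>?Q) - (\<integral>\<omega>. g \<omega> \<partial>?P))\<^sup>2"
    by (intro tendsto_intros integral_not_visited_tendsto transient g g')
  then show ?thesis
    by (rule LIMSEQ_le_const2) (auto intro: bound)
qed

section \<open>Exponential moments of the number of visits\<close>

text \<open>The weight is \<open>(1 + \<delta>) ^ k\<close>, where \<open>k\<close> is the number of visits to \<open>w\<close> before time \<open>n\<close>.\<close>

definition visit_weight :: "real \<Rightarrow> 's \<Rightarrow> nat \<Rightarrow> (nat \<Rightarrow> 's) \<Rightarrow> real"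
  where "visit_weight \<delta> w n \<omega> = (\<Prod>t<n. 1 + \<delta> * indicator {w} (\<omega> t))"

lemma adapted_visit_weight: "n \<le> m \<Longrightarrow> adapted m (visit_weight \<delta> w n)"
  by (auto simp: adapted_def visit_weight_def intro!: prod.cong)

text \<open>The weight changes only at visits, and the visit at time \<open>k\<close> adds \<open>\<delta>\<close> times the weight so far.\<close>

lemma visit_weight_eq_sum:
  "visit_weight \<delta> w n \<omega> = 1 + \<delta> * (\<Sum>k<n. visit_weight \<delta> w k \<omega> * indicator {w} (\<omega> k))"
  by (induction n) (simp_all add: visit_weight_def algebra_simps)

text \<open>
  A path that visits \<open>w\<close> at time \<open>m\<close> and again \<open>j\<close> steps later visits \<open>w\<close> at time \<open>m + j\<close>. By the
  Markov property, the two visits together have probability \<open>visit_prob K s w m * visit_prob K w w j\<close>.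
\<close>

lemma summable_return_prob:
  fixes K :: "'s::finite \<Rightarrow> 's pmf"
  assumes "summable (visit_prob K s w)" and pos: "0 < visit_prob K s w m"
  shows "summable (visit_prob K w w)"
proof -
  have le: "visit_prob K s w m * visit_prob K w w j \<le> visit_prob K s w (j + m)" for j
  proof -
    have "visit_prob K s w m * visit_prob K w w j =
        (\<integral>\<omega>. indicator {w} (\<omega> m) * indicator {w} (\<omega> (m + j)) \<partial>path_measure K s)"
      using markov_property[OF adapted_const[of m 1], where z=w and \<psi>="indicator {w}" and K=K and s=s and j=j]
      by (simp add: visit_prob_def)
    also have "\<dots> \<le> (\<integral>\<omega>. indicator {w} (\<omega> (m + j)) \<partial>path_measure K s)"
    proof (intro integral_mono integrable_adapted[where n="m + j"] adapted_mult adapted_coordinate)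
      show "indicat_real {w} (\<omega> m) * indicator {w} (\<omega> (m + j)) \<le> indicator {w} (\<omega> (m + j))" for \<omega>
        by (simp add: indicator_def)
    qed auto
    finally show ?thesis
      by (simp add: visit_prob_def add.commute)
  qed
  have "summable (\<lambda>j. visit_prob K s w m * visit_prob K w w j)"
    by (rule summable_comparison_test'[OF summable_ignore_initial_segment[OF assms(1), of m], where N=0])
      (use le in \<open>simp add: visit_prob_nonneg\<close>)
  then show ?thesis
    using pos by (subst (asm) summable_cmult_iff) auto
qed

text \<open>
  Let \<open>u n\<close> be the expectation of the weight at time \<open>n\<close> on a visit at time \<open>n\<close>. Expanding the weight
  over the earlier visits and restarting the chain at each of them gives the renewal equation
  \<open>u n = visit_prob K s w n + \<delta> * (\<Sum>k<n. u k * visit_prob K w w (n - k))\<close>. Summing over \<open>n < N\<close> bounds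
  the partial sum \<open>U\<close> of \<open>u\<close> by \<open>(\<Sum>n. visit_prob K s w n) + \<delta> * U * (\<Sum>n. visit_prob K w w n)\<close>, and
  the condition on \<open>\<delta>\<close> permits solving for \<open>U\<close>.
\<close>

lemma sum_visit_weight_le:
  fixes K :: "'s::finite \<Rightarrow> 's pmf"
  assumes s: "summable (visit_prob K s w)" and ret: "summable (visit_prob K w w)"
    and \<delta>: "0 \<le> \<delta>" "\<delta> * (\<Sum>n. visit_prob K w w n) < 1"
  shows "(\<Sum>n<N. \<integral>\<omega>. visit_weight \<delta> w n \<omega> * indicator {w} (\<omega> n) \<partial>path_measure K s) \<le>
    (\<Sum>n. visit_prob K s w n) / (1 - \<delta> * (\<Sum>n. visit_prob K w w n))"
proof -
  define u where "u n = (\<integral>\<omega>. visit_weight \<delta> w n \<omega> * indicator {w} (\<omega> n) \<partial>path_measure K s)" for n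
  define g where "g = visit_prob K w w"
  have u_nonneg: "0 \<le> u n" for n
    unfolding u_def visit_weight_def using \<delta>(1)
    by (intro integral_nonneg_AE AE_I2 mult_nonneg_nonneg prod_nonneg) auto
  have g_nonneg: "0 \<le> g n" for n
    by (simp add: g_def visit_prob_nonneg)
  have u_eq: "u n = visit_prob K s w n + \<delta> * (\<Sum>k<n. u k * g (n - k))" for n
  proof -
    let ?f = "\<lambda>k \<omega>. visit_weight \<delta> w k \<omega> * indicator {w} (\<omega> k) * indicator {w} (\<omega> (k + (n - k)))"
    have int: "integrable (path_measure K s) (?f k)" if "k \<in> {..<n}" for k
      using that by (intro integrable_adapted[where n=n] adapted_mult adapted_visit_weight adapted_coordinate) auto
    have int': "integrable (path_measure K s) (\<lambda>\<omega>. indicat_real {w} (\<omega> n))"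
      by (intro integrable_adapted[where n=n] adapted_coordinate) simp
    have "visit_weight \<delta> w n \<omega> * indicator {w} (\<omega> n) = indicator {w} (\<omega> n) + \<delta> * (\<Sum>k<n. ?f k \<omega>)" for \<omega>
    proof -
      have "(\<Sum>k<n. ?f k \<omega>) = (\<Sum>k<n. visit_weight \<delta> w k \<omega> * indicator {w} (\<omega> k)) * indicator {w} (\<omega> n)"
        unfolding sum_distrib_right by (rule sum.cong) auto
      then show ?thesis
        by (subst visit_weight_eq_sum) (simp only: distrib_right mult_1 mult.assoc)
    qed
    then have "u n = (\<integral>\<omega>. indicator {w} (\<omega> n) + \<delta> * (\<Sum>k<n. ?f k \<omega>) \<partial>path_measure K s)"
      by (simp add: u_def)
    also have "\<dots> = visit_prob K s w n + \<delta> * (\<Sum>k<n. \<integral>\<omega>. ?f k \<omega> \<partial>path_measure K s)"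
      by (simp only: Bochner_Integration.integral_add[OF int' integrable_mult_right[OF Bochner_Integration.integrable_sum[OF int]]]
          integral_mult_right_zero Bochner_Integration.integral_sum[OF int] visit_prob_def)
    also have "(\<Sum>k<n. \<integral>\<omega>. ?f k \<omega> \<partial>path_measure K s) = (\<Sum>k<n. u k * g (n - k))"
      unfolding u_def g_def visit_prob_def
      by (rule sum.cong[OF refl], rule markov_property, rule adapted_visit_weight) simp
    finally show ?thesis .
  qed
  define U where "U = (\<Sum>n<N. u n)"
  have "(\<Sum>n<N. \<Sum>k<n. u k * g (n - k)) = (\<Sum>k<N. u k * (\<Sum>n\<in>{Suc k..<N}. g (n - k)))"
  proof (induction N)
    case (Suc N)
    have "(\<Sum>n\<in>{Suc k..<Suc N}. g (n - k)) = (\<Sum>n\<in>{Suc k..<N}. g (n - k)) + g (N - k)" if "k < N" for k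
      using that by (subst sum.op_ivl_Suc) simp
    then show ?case
      by (simp add: Suc.IH distrib_left sum.distrib)
  qed simp
  also have "\<dots> \<le> (\<Sum>k<N. u k * (\<Sum>n. g n))"
  proof (intro sum_mono mult_left_mono u_nonneg)
    fix k
    have "(\<Sum>n\<in>{Suc k..<N}. g (n - k)) = (\<Sum>j\<in>(\<lambda>n. n - k) ` {Suc k..<N}. g j)"
      by (subst sum.reindex) (auto simp: inj_on_def)
    also have "\<dots> \<le> (\<Sum>n. g n)"
      using ret by (intro sum_le_suminf) (auto simp: g_def visit_prob_nonneg)
    finally show "(\<Sum>n\<in>{Suc k..<N}. g (n - k)) \<le> (\<Sum>n. g n)" .
  qed
  also have "\<dots> = U * (\<Sum>n. g n)"
    by (simp add: U_def sum_distrib_right)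
  finally have conv: "(\<Sum>n<N. \<Sum>k<n. u k * g (n - k)) \<le> U * (\<Sum>n. g n)" .
  have "U = (\<Sum>n<N. visit_prob K s w n) + \<delta> * (\<Sum>n<N. \<Sum>k<n. u k * g (n - k))"
    unfolding U_def sum_distrib_left sum.distrib[symmetric]
    by (rule sum.cong[OF refl]) (subst u_eq, simp add: sum_distrib_left)
  also have "\<dots> \<le> (\<Sum>n. visit_prob K s w n) + \<delta> * (U * (\<Sum>n. g n))"
    using s \<delta>(1) conv by (intro add_mono sum_le_suminf mult_left_mono) (auto simp: visit_prob_nonneg)
  finally have "U * (1 - \<delta> * (\<Sum>n. g n)) \<le> (\<Sum>n. visit_prob K s w n)"
    by (simp add: algebra_simps)
  then show ?thesis
    using \<delta>(2) by (simp add: pos_le_divide_eq U_def u_def g_def)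
qed

section \<open>Perturbing the transition distribution at one state\<close>

text \<open>
  The number \<open>c\<close> is the chi-square divergence of the two transition distributions at \<open>w\<close>. Conditioning on the
  first \<open>n\<close> steps shows that the second moment of the likelihood ratio grows in step \<open>n + 1\<close> by \<open>c\<close> times its
  second moment on a visit at time \<open>n\<close>. Each visit multiplies the likelihood ratio by at most \<open>1 + b\<close>,
  hence its square by at most \<open>1 + \<delta>\<close>, and the renewal bound controls the sum of these increments. The same
  bound shows that the perturbed chain also visits \<open>w\<close> finitely often.
\<close>

lemma local_perturbation_bound:
  fixes K K' :: "'s::finite \<Rightarrow> 's pmf"
  assumes K': "\<And>y r. pmf (K' y) r = pmf (K y) r * \<phi> y r"
    and nonneg: "\<And>y r. 0 \<le> \<phi> y r"
    and \<phi>: "\<And>y r. y \<noteq> w \<Longrightarrow> \<phi> y r = 1"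
    and ratio: "0 \<le> b" "\<And>r. \<phi> w r \<le> 1 + b"
    and chi: "(\<Sum>r\<in>UNIV. pmf (K w) r * (\<phi> w r)\<^sup>2) = 1 + c" "0 \<le> c"
    and s: "summable (visit_prob K s w)" and ret: "summable (visit_prob K w w)"
    and \<delta>: "\<delta> = (1 + b)\<^sup>2 - 1" "\<delta> * (\<Sum>n. visit_prob K w w n) < 1"
    and meas: "g \<in> borel_measurable path_space"
    and g2: "integrable (path_measure K s) (\<lambda>\<omega>. (g \<omega>)\<^sup>2)"
    and g': "integrable (path_measure K' s) g"
  shows "((\<integral>\<omega>. g \<omega> \<partial>path_measure K' s) - (\<integral>\<omega>. g \<omega> \<partial>path_measure K s))\<^sup>2
    \<le> (\<integral>\<omega>. (g \<omega>)\<^sup>2 \<partial>path_measure K s) *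
      (c * ((\<Sum>n. visit_prob K s w n) / (1 - \<delta> * (\<Sum>n. visit_prob K w w n))))"
proof (rule chapman_robbins[OF K' nonneg \<phi> s _ _ meas g2 g'])
  let ?P = "path_measure K s" and ?L = "likelihood_ratio \<phi>"
  let ?u = "\<lambda>n. \<integral>\<omega>. visit_weight \<delta> w n \<omega> * indicator {w} (\<omega> n) \<partial>?P"
  let ?U = "(\<Sum>n. visit_prob K s w n) / (1 - \<delta> * (\<Sum>n. visit_prob K w w n))"
  interpret P: prob_space ?P
    by (rule prob_space_path_measure)
  have \<delta>_nonneg: "0 \<le> \<delta>"
    using ratio(1) by (simp add: \<delta> power2_eq_square algebra_simps)
  have U: "(\<Sum>n<N. ?u n) \<le> ?U" for N
    by (rule sum_visit_weight_le[OF s ret \<delta>_nonneg \<delta>(2)])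
  have u_nonneg: "0 \<le> ?u n" for n
    unfolding visit_weight_def using \<delta>_nonneg
    by (intro integral_nonneg_AE AE_I2 mult_nonneg_nonneg prod_nonneg) auto
  have lr_nonneg: "0 \<le> ?L n \<omega>" for n \<omega>
    unfolding likelihood_ratio_def by (intro prod_nonneg nonneg ballI)
  \<comment> \<open>The weight with parameter \<open>\<delta>\<close> is the square of the weight with parameter \<open>b\<close>, which dominates the likelihood ratio.\<close>
  have W_eq: "visit_weight \<delta> w n \<omega> = (\<Prod>t<n. 1 + b * indicator {w} (\<omega> t))\<^sup>2" for n \<omega>
    unfolding visit_weight_def prod_power_distrib
    by (rule prod.cong) (auto simp: \<delta> indicator_def)
  have lr_le: "?L n \<omega> \<le> (\<Prod>t<n. 1 + b * indicator {w} (\<omega> t))" for n \<omega>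
    unfolding likelihood_ratio_def by (intro prod_mono) (auto simp: indicator_def nonneg ratio \<phi>)
  have one_le: "1 \<le> (\<Prod>t<n. 1 + b * indicator {w} (\<omega> t))" for n \<omega>
    using ratio(1) by (intro prod_ge_1) auto
  have lr2_le: "(?L n \<omega>)\<^sup>2 \<le> visit_weight \<delta> w n \<omega>" for n \<omega>
    unfolding W_eq by (intro power_mono lr_le lr_nonneg)
  have lr1_le: "?L n \<omega> \<le> visit_weight \<delta> w n \<omega>" for n \<omega>
    unfolding W_eq using lr_le[of n \<omega>] self_le_power[OF one_le, of 2] by (rule order_trans) simp
  note ad = adapted_likelihood_ratio[OF order_refl, of _ \<phi>]
  show "summable (visit_prob K' s w)"
  proof (rule summableI_nonneg_bounded)
    fix N
    have "visit_prob K' s w n \<le> ?u n" for n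
    proof -
      have "visit_prob K' s w n = (\<integral>\<omega>. indicator {w} (\<omega> n) * ?L n \<omega> \<partial>?P)"
        unfolding visit_prob_def by (rule integral_change_of_measure[OF K' adapted_coordinate]) simp
      also have "\<dots> \<le> ?u n"
      proof (intro integral_mono integrable_adapted[where n=n] adapted_mult adapted_coordinate ad adapted_visit_weight)
        show "indicator {w} (\<omega> n) * ?L n \<omega> \<le> visit_weight \<delta> w n \<omega> * indicator {w} (\<omega> n)" for \<omega>
          using lr1_le[of n \<omega>] by (simp add: indicator_def)
      qed auto
      finally show ?thesis .
    qed
    then have "(\<Sum>n<N. visit_prob K' s w n) \<le> (\<Sum>n<N. ?u n)"
      by (rule sum_mono)
    also note U
    finally show "(\<Sum>n<N. visit_prob K' s w n) \<le> ?U" .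
  qed (rule visit_prob_nonneg)
  have second_moment: "(\<integral>\<omega>. (?L n \<omega>)\<^sup>2 \<partial>?P) \<le> 1 + c * (\<Sum>k<n. ?u k)" for n
  proof (induction n)
    case 0
    then show ?case
      using P.prob_space by (simp add: likelihood_ratio_def)
  next
    case (Suc n)
    have kernel: "(\<Sum>r\<in>UNIV. pmf (K y) r * (\<phi> y r)\<^sup>2) = 1 + c * indicator {w} y" for y
      using chi(1) \<phi>[of y] sum_pmf_eq_1[of UNIV "K y"] by (cases "y = w") auto
    have ad2: "adapted n (\<lambda>\<omega>. (?L n \<omega>)\<^sup>2)"
      by (rule adapted_power[OF ad])
    have int: "integrable ?P (\<lambda>\<omega>. (?L n \<omega>)\<^sup>2)"
      by (rule integrable_adapted[OF ad2])
    have int': "integrable ?P (\<lambda>\<omega>. (?L n \<omega>)\<^sup>2 * indicator {w} (\<omega> n))"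
      by (rule integrable_adapted[OF adapted_mult[OF ad2 adapted_coordinate]]) simp
    have "(\<integral>\<omega>. (?L (Suc n) \<omega>)\<^sup>2 \<partial>?P) = (\<integral>\<omega>. (?L n \<omega>)\<^sup>2 * (\<phi> (\<omega> n) (\<omega> (Suc n)))\<^sup>2 \<partial>?P)"
      by (simp add: likelihood_ratio_def power_mult_distrib)
    also have "\<dots> = (\<integral>\<omega>. (?L n \<omega>)\<^sup>2 * (1 + c * indicator {w} (\<omega> n)) \<partial>?P)"
      using integral_one_step[OF ad2, where \<phi>="\<lambda>y r. (\<phi> y r)\<^sup>2"] by (simp add: kernel)
    also have "\<dots> = (\<integral>\<omega>. (?L n \<omega>)\<^sup>2 + c * ((?L n \<omega>)\<^sup>2 * indicator {w} (\<omega> n)) \<partial>?P)"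
      by (simp add: algebra_simps)
    also have "\<dots> = (\<integral>\<omega>. (?L n \<omega>)\<^sup>2 \<partial>?P) + c * (\<integral>\<omega>. (?L n \<omega>)\<^sup>2 * indicator {w} (\<omega> n) \<partial>?P)"
      using int int' by simp
    also have "(\<integral>\<omega>. (?L n \<omega>)\<^sup>2 * indicator {w} (\<omega> n) \<partial>?P) \<le> ?u n"
    proof (intro integral_mono int' integrable_adapted[where n=n] adapted_mult adapted_coordinate adapted_visit_weight)
      show "(?L n \<omega>)\<^sup>2 * indicator {w} (\<omega> n) \<le> visit_weight \<delta> w n \<omega> * indicator {w} (\<omega> n)" for \<omega>
        by (intro mult_right_mono lr2_le) simp
    qed auto
    finally show ?case
      using Suc.IH chi(2) by (simp add: distrib_left mult_left_mono)
  qed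
  fix n
  have ad2: "adapted n (\<lambda>\<omega>. (?L n \<omega>)\<^sup>2)"
    by (rule adapted_power[OF ad])
  have mean: "(\<integral>\<omega>. ?L n \<omega> \<partial>?P) = 1"
  proof -
    interpret Q: prob_space "path_measure K' s"
      by (rule prob_space_path_measure)
    show ?thesis
      using integral_change_of_measure[where s=s, OF K' adapted_const[of n 1]] Q.prob_space by simp
  qed
  have "(\<integral>\<omega>. (?L n \<omega> - 1)\<^sup>2 \<partial>?P) = (\<integral>\<omega>. (?L n \<omega>)\<^sup>2 - 2 * ?L n \<omega> + 1 \<partial>?P)"
    by (simp add: power2_diff algebra_simps)
  also have "\<dots> = (\<integral>\<omega>. (?L n \<omega>)\<^sup>2 \<partial>?P) - 1"
    using integrable_adapted[OF ad2, of K s] integrable_adapted[OF ad, of K s n] mean P.prob_space by simp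
  also have "\<dots> \<le> c * (\<Sum>k<n. ?u k)"
    using second_moment[of n] by simp
  also have "\<dots> \<le> c * ?U"
    by (intro mult_left_mono U chi(2))
  finally show "(\<integral>\<omega>. (?L n \<omega> - 1)\<^sup>2 \<partial>?P) \<le> c * ?U" .
qed

section \<open>The variance bound for one transition probability\<close>

definition tilt :: "real \<Rightarrow> 's \<Rightarrow> 's pmf \<Rightarrow> 's pmf"
  where "tilt h q p = bind_pmf (bernoulli_pmf h) (\<lambda>b. if b then return_pmf q else p)"

lemma pmf_tilt:
  assumes "0 \<le> h" "h \<le> 1"
  shows "pmf (tilt h q p) r = (1 - h) * pmf p r + h * indicator {q} r"
  using assms by (simp add: tilt_def pmf_bind pmf_return indicator_def mult.commute)

lemma set_pmf_tilt: "set_pmf (tilt h q p) \<subseteq> insert q (set_pmf p)"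
  by (auto simp: tilt_def split: if_splits)

text \<open>
  Let \<open>p\<close> be the probability of \<open>q\<close> and \<open>b = 1 / p - 1\<close>. For the mixture with weight \<open>h\<close> on \<open>q\<close>, the likelihood ratio of a step from \<open>w\<close> is \<open>1 - h + h / p\<close> or
  \<open>1 - h\<close>, which is at most \<open>1 + h * b\<close>, and the chi-square divergence is \<open>h\<^sup>2 * b\<close>. Both the squared
  change of the mean and the divergence are of order \<open>h\<^sup>2\<close>, which cancels, and the factor \<open>1 - \<delta> * G\<close>
  from the renewal bound tends to \<open>1\<close> as \<open>h \<rightarrow> 0\<close>. Since \<open>q\<close> lies in the support of the true distribution, the mixture
  is absolutely continuous with respect to it.
\<close>

lemma coordinate_variance_bound:
  fixes K :: "'s::finite \<Rightarrow> 's pmf"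
  assumes q: "q \<in> set_pmf (K w)"
    and s: "summable (visit_prob K s w)" and reach: "0 < visit_prob K s w m"
    and meas: "f \<in> borel_measurable path_space"
    and f2: "integrable (path_measure K s) (\<lambda>\<omega>. (f \<omega> - pmf (K w) q)\<^sup>2)"
    and unbiased: "\<And>\<theta>. set_pmf \<theta> \<subseteq> set_pmf (K w) \<Longrightarrow>
      integrable (path_measure (K(w := \<theta>)) s) f \<and> (\<integral>\<omega>. f \<omega> \<partial>path_measure (K(w := \<theta>)) s) = pmf \<theta> q"
  shows "pmf (K w) q * (1 - pmf (K w) q) \<le>
    (\<integral>\<omega>. (f \<omega> - pmf (K w) q)\<^sup>2 \<partial>path_measure K s) * (\<Sum>n. visit_prob K s w n)"
proof -
  define p where "p = pmf (K w) q"
  define V where "V = (\<integral>\<omega>. (f \<omega> - p)\<^sup>2 \<partial>path_measure K s)"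
  define X where "X = (\<Sum>n. visit_prob K s w n)"
  define G where "G = (\<Sum>n. visit_prob K w w n)"
  define b where "b = 1 / p - 1"
  have p: "0 < p" "p \<le> 1"
    using q by (auto simp: p_def pmf_positive pmf_le_1)
  have b: "0 \<le> b"
    using p by (simp add: b_def)
  have ret: "summable (visit_prob K w w)"
    by (rule summable_return_prob[OF s reach])
  have V_nonneg: "0 \<le> V"
    unfolding V_def by (rule integral_nonneg_AE) simp
  have X_nonneg: "0 \<le> X"
    unfolding X_def by (rule suminf_nonneg[OF s visit_prob_nonneg])
  let ?\<delta> = "\<lambda>h. (1 + h * b)\<^sup>2 - 1"
  have bound: "(1 - p)\<^sup>2 * (1 - ?\<delta> h * G) \<le> V * (b * X)" if h: "0 < h" "h \<le> 1" and \<delta>: "?\<delta> h * G < 1" for h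
  proof -
    define \<theta> where "\<theta> = tilt h q (K w)"
    define \<phi> where "\<phi> y r = (if y = w then 1 - h + h * indicator {q} r / p else 1)" for y r
    have \<theta>_pmf: "pmf \<theta> r = (1 - h) * pmf (K w) r + h * indicator {q} r" for r
      unfolding \<theta>_def using h by (intro pmf_tilt) auto
    have \<theta>_set: "set_pmf \<theta> \<subseteq> set_pmf (K w)"
      using set_pmf_tilt[of h q "K w"] q by (auto simp: \<theta>_def)
    have K_same: "K(w := K w) = K"
      by simp
    interpret P: prob_space "path_measure K s"
      by (rule prob_space_path_measure)
    interpret Q: prob_space "path_measure (K(w := \<theta>)) s"
      by (rule prob_space_path_measure)
    have EQ: "(\<integral>\<omega>. f \<omega> - p \<partial>path_measure (K(w := \<theta>)) s) = pmf \<theta> q - p"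
      using unbiased[OF \<theta>_set] Q.prob_space by simp
    have EP: "(\<integral>\<omega>. f \<omega> - p \<partial>path_measure K s) = 0"
      using unbiased[of "K w"] P.prob_space by (simp add: p_def)
    have chi: "(\<Sum>r\<in>UNIV. pmf (K w) r * (\<phi> w r)\<^sup>2) = 1 + h\<^sup>2 * b"
    proof -
      have "(\<Sum>r\<in>UNIV. pmf (K w) r * (\<phi> w r)\<^sup>2) =
          (\<Sum>r\<in>UNIV. (1 - h)\<^sup>2 * pmf (K w) r + (if r = q then p * ((1 - h + h / p)\<^sup>2 - (1 - h)\<^sup>2) else 0))"
        by (intro sum.cong) (auto simp: \<phi>_def p_def algebra_simps)
      also have "\<dots> = (1 - h)\<^sup>2 + p * ((1 - h + h / p)\<^sup>2 - (1 - h)\<^sup>2)"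
        using sum_pmf_eq_1[of UNIV "K w"] by (simp add: sum.distrib sum_distrib_left[symmetric])
      also have "\<dots> = 1 + h\<^sup>2 * b"
        using p by (simp add: b_def power2_eq_square field_simps)
      finally show ?thesis .
    qed
    have "((\<integral>\<omega>. f \<omega> - p \<partial>path_measure (K(w := \<theta>)) s) - (\<integral>\<omega>. f \<omega> - p \<partial>path_measure K s))\<^sup>2
      \<le> V * ((h\<^sup>2 * b) * (X / (1 - ?\<delta> h * G)))"
      unfolding V_def X_def G_def
    proof (rule local_perturbation_bound[where \<phi>=\<phi> and b="h * b"])
      show "pmf ((K(w := \<theta>)) y) r = pmf (K y) r * \<phi> y r" for y r
        using p unfolding p_def by (auto simp: \<phi>_def \<theta>_pmf p_def indicator_def field_simps)
      show "0 \<le> \<phi> y r" for y r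
        using h p by (auto simp: \<phi>_def)
      show "\<phi> w r \<le> 1 + h * b" for r
        using h p mult_nonneg_nonneg[of h "1/p"] by (auto simp: \<phi>_def b_def algebra_simps indicator_def)
      show "(\<lambda>\<omega>. f \<omega> - p) \<in> borel_measurable path_space"
        using meas by measurable
      show "integrable (path_measure K s) (\<lambda>\<omega>. (f \<omega> - p)\<^sup>2)"
        using f2 by (simp add: p_def)
      show "integrable (path_measure (K(w := \<theta>)) s) (\<lambda>\<omega>. f \<omega> - p)"
        using unbiased[OF \<theta>_set] by simp
    qed (use h b chi s ret \<delta> in \<open>auto simp: \<phi>_def G_def\<close>)
    also have "(\<integral>\<omega>. f \<omega> - p \<partial>path_measure (K(w := \<theta>)) s) - (\<integral>\<omega>. f \<omega> - p \<partial>path_measure K s) = h * (1 - p)"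
      unfolding EQ EP by (simp add: \<theta>_pmf p_def algebra_simps)
    finally have "h\<^sup>2 * (1 - p)\<^sup>2 \<le> h\<^sup>2 * (V * (b * X) / (1 - ?\<delta> h * G))"
      by (simp add: power_mult_distrib mult_ac)
    then have "(1 - p)\<^sup>2 \<le> V * (b * X) / (1 - ?\<delta> h * G)"
      using h by (subst (asm) mult_le_cancel_left_pos) auto
    then show ?thesis
      using \<delta> by (simp add: pos_le_divide_eq)
  qed
  have "((\<lambda>h. ?\<delta> h * G) \<longlongrightarrow> ?\<delta> 0 * G) (at_right 0)"
    by (intro tendsto_intros)
  then have \<delta>_lim: "((\<lambda>h. ?\<delta> h * G) \<longlongrightarrow> 0) (at_right 0)"
    by simp
  have "((\<lambda>h. (1 - p)\<^sup>2 * (1 - ?\<delta> h * G)) \<longlongrightarrow> (1 - p)\<^sup>2 * (1 - 0)) (at_right 0)"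
    by (intro tendsto_intros \<delta>_lim)
  then have "(1 - p)\<^sup>2 * (1 - 0) \<le> V * (b * X)"
  proof (rule tendsto_upperbound)
    have "\<forall>\<^sub>F h in at_right 0. ?\<delta> h * G < 1"
      by (rule order_tendstoD(2)[OF \<delta>_lim]) simp
    moreover have "\<forall>\<^sub>F h in at_right (0::real). h < 1"
      by (rule eventually_at_right_real[THEN eventually_mono, of 0 1]) auto
    moreover have "\<forall>\<^sub>F h in at_right (0::real). 0 < h"
      by (simp add: eventually_at_right_less)
    ultimately show "\<forall>\<^sub>F h in at_right 0. (1 - p)\<^sup>2 * (1 - ?\<delta> h * G) \<le> V * (b * X)"
      by eventually_elim (rule bound, auto)
  qed simp
  then have "p * (1 - p)\<^sup>2 \<le> p * (V * (b * X))"
    using p by (intro mult_left_mono) auto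
  also have "\<dots> = (1 - p) * (V * X)"
    using p by (simp add: b_def field_simps)
  finally have "(1 - p) * (p * (1 - p)) \<le> (1 - p) * (V * X)"
    by (simp add: power2_eq_square mult_ac)
  then have "p * (1 - p) \<le> V * X"
    using p V_nonneg X_nonneg by (cases "p = 1") auto
  then show ?thesis
    by (simp add: p_def V_def X_def)
qed

lemma residence_time_eq:
  assumes "residence_time K s w < \<infinity>"
  shows "summable (visit_prob K s w)" "residence_time K s w = ennreal (\<Sum>n. visit_prob K s w n)"
proof -
  interpret prob_space "path_measure K s"
    by (rule prob_space_path_measure)
  have eq: "residence_time K s w = (\<Sum>n. ennreal (visit_prob K s w n))"
    by (simp add: residence_time_def visit_prob_eq_measure emeasure_eq_measure)
  show *: "summable (visit_prob K s w)"
    using assms unfolding eq by (intro summable_suminf_not_top) (auto simp: visit_prob_nonneg)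
  show "residence_time K s w = ennreal (\<Sum>n. visit_prob K s w n)"
    unfolding eq by (rule suminf_ennreal2[OF visit_prob_nonneg *])
qed

lemma reach_prob_pos_imp_visit_prob_pos:
  assumes "reach_prob K s w \<noteq> 0"
  obtains m where "0 < visit_prob K s w m"
proof -
  interpret prob_space "path_measure K s"
    by (rule prob_space_path_measure)
  have "reach_prob K s w = emeasure (path_measure K s) (\<Union>t. {\<omega>. \<omega> t = w})"
    unfolding reach_prob_def by (rule arg_cong[where f="emeasure _"]) auto
  moreover have "emeasure (path_measure K s) (\<Union>t. {\<omega>. \<omega> t = w}) = 0"
    if "\<And>t. emeasure (path_measure K s) {\<omega>. \<omega> t = w} = 0"
    by (rule emeasure_UN_eq_0[OF that]) (use sets_visit in auto)
  ultimately have "\<exists>m. emeasure (path_measure K s) {\<omega>. \<omega> m = w} \<noteq> 0"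
    using assms by fastforce
  then show ?thesis
    using that visit_prob_nonneg[of K s w]
    by (auto simp: visit_prob_eq_measure emeasure_eq_measure less_le)
qed

lemma residence_time_nonzero:
  assumes "reach_prob K s w \<noteq> 0"
  shows "residence_time K s w \<noteq> 0"
proof
  assume zero: "residence_time K s w = 0"
  obtain m where m: "0 < visit_prob K s w m"
    by (rule reach_prob_pos_imp_visit_prob_pos[OF assms])
  have fin: "residence_time K s w < \<infinity>"
    by (simp add: zero)
  have "0 < (\<Sum>n. visit_prob K s w n)"
    by (rule suminf_pos2[OF residence_time_eq(1)[OF fin] visit_prob_nonneg m])
  then show False
    using residence_time_eq(2)[OF fin] zero by simp
qed

section \<open>The bound for the mean squared error\<close>

theorem proposition4:
  fixes M :: "('s::finite, 'a::finite) mdp"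
    and \<pi> :: "'s \<Rightarrow> 'a pmf"
    and W :: "'s set"
    and w :: 's
    and est :: "(nat \<Rightarrow> 's) \<Rightarrow> 's \<Rightarrow> real"
  assumes "\<pi> \<in> stationary_policies M"
    and "w \<in> W"
    and "unbiased_estimator M \<pi> w est"
  shows "mean_squared_error M \<pi> w est \<ge>
    (reach_prob (induced_chain M \<pi>) (init M) w)\<^sup>2 /
      (residence_time (induced_chain M \<pi>) (init M) w * transition_information M \<pi> w)"
proof -
  define K where "K = induced_chain M \<pi>"
  define s where "s = init M"
  define v where "v = (\<Sum>q\<in>Succ M w. pmf (K w) q * (1 - pmf (K w) q))"
  let ?P = "path_measure K s"
  interpret P: prob_space ?P
    by (rule prob_space_path_measure)
  have info: "transition_information M \<pi> w = inverse (ennreal v)"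
    by (simp add: transition_information_def v_def K_def)
  have info_pos: "transition_information M \<pi> w \<noteq> 0"
    by (simp add: info ennreal_inverse_eq_0_iff)
  have mse: "mean_squared_error M \<pi> w est = (\<Sum>q\<in>Succ M w. \<integral>\<^sup>+\<omega>. ennreal ((est \<omega> q - pmf (K w) q)\<^sup>2) \<partial>?P)"
    by (simp add: mean_squared_error_def model_def K_def s_def)
  \<comment> \<open>In the first three cases the right-hand side is \<open>0\<close>: either the numerator vanishes or the denominator is infinite.\<close>
  consider "reach_prob K s w = 0" | "residence_time K s w = \<infinity>" | "v = 0" | "mean_squared_error M \<pi> w est = \<infinity>"
    | (main) "reach_prob K s w \<noteq> 0" "residence_time K s w < \<infinity>" "v \<noteq> 0" "mean_squared_error M \<pi> w est < \<infinity>"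
    unfolding infinity_ennreal_def less_top[symmetric] by blast
  then have "(reach_prob K s w)\<^sup>2 / (residence_time K s w * transition_information M \<pi> w)
    \<le> mean_squared_error M \<pi> w est"
  proof cases
    case main
    have supp: "set_pmf (K w) \<subseteq> Succ M w"
    proof
      fix q assume "q \<in> set_pmf (K w)"
      then obtain a where "a \<in> set_pmf (\<pi> w)" "q \<in> set_pmf (transition M w a)"
        by (auto simp: K_def induced_chain_def)
      then show "q \<in> Succ M w"
        using assms(1) by (auto simp: stationary_policies_def Succ_def intro!: bexI[of _ a] pmf_positive)
    qed
    obtain m where m: "0 < visit_prob K s w m"
      by (rule reach_prob_pos_imp_visit_prob_pos[OF main(1)])
    note rt = residence_time_eq[OF main(2)]
    define X where "X = (\<Sum>n. visit_prob K s w n)"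
    have X: "0 < X"
      unfolding X_def by (rule suminf_pos2[OF rt(1) visit_prob_nonneg m])
    have v: "0 < v"
      using main(3) sum_nonneg[of "Succ M w" "\<lambda>q. pmf (K w) q * (1 - pmf (K w) q)"]
      by (simp add: v_def pmf_le_1 less_le)
    have coord: "ennreal (pmf (K w) q * (1 - pmf (K w) q) / X) \<le>
        (\<integral>\<^sup>+\<omega>. ennreal ((est \<omega> q - pmf (K w) q)\<^sup>2) \<partial>?P)" if q: "q \<in> Succ M w" for q
    proof (cases "q \<in> set_pmf (K w)")
      case True
      have [measurable]: "(\<lambda>\<omega>. est \<omega> q) \<in> borel_measurable path_space"
        using assms(3) q unfolding unbiased_estimator_def
        by (auto intro: measurable_compose[OF _ measurable_component_singleton])
      have "(\<integral>\<^sup>+\<omega>. ennreal ((est \<omega> q - pmf (K w) q)\<^sup>2) \<partial>?P) < \<infinity>"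
        using main(4) q unfolding mse by (auto simp: less_top)
      then have int: "integrable ?P (\<lambda>\<omega>. (est \<omega> q - pmf (K w) q)\<^sup>2)"
        by (intro integrableI_bounded) auto
      have "pmf (K w) q * (1 - pmf (K w) q) \<le> (\<integral>\<omega>. (est \<omega> q - pmf (K w) q)\<^sup>2 \<partial>?P) * X"
        unfolding X_def
      proof (rule coordinate_variance_bound[OF True rt(1) m _ int])
        show "integrable (path_measure (K(w := \<theta>)) s) (\<lambda>\<omega>. est \<omega> q) \<and>
            (\<integral>\<omega>. est \<omega> q \<partial>path_measure (K(w := \<theta>)) s) = pmf \<theta> q" if "set_pmf \<theta> \<subseteq> set_pmf (K w)" for \<theta>
          using assms(3) q that supp by (auto simp: unbiased_estimator_def model_def K_def s_def)
      qed simp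
      then have "pmf (K w) q * (1 - pmf (K w) q) / X \<le> (\<integral>\<omega>. (est \<omega> q - pmf (K w) q)\<^sup>2 \<partial>?P)"
        using X by (simp add: pos_divide_le_eq)
      then show ?thesis
        by (subst nn_integral_eq_integral[OF int]) (auto intro: ennreal_leI)
    qed (simp add: set_pmf_iff)
    have "(reach_prob K s w)\<^sup>2 \<le> 1"
      using P.emeasure_le_1 unfolding reach_prob_def by (simp add: power_le_one)
    then have "(reach_prob K s w)\<^sup>2 / (residence_time K s w * transition_information M \<pi> w) \<le>
        1 / (ennreal X * inverse (ennreal v))"
      unfolding rt(2) X_def[symmetric] info by (rule divide_right_mono_ennreal)
    also have "\<dots> = ennreal (v / X)"
      using v X by (simp add: inverse_ennreal divide_ennreal ennreal_mult[symmetric] divide_ennreal_def field_simps)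
    also have "\<dots> = (\<Sum>q\<in>Succ M w. ennreal (pmf (K w) q * (1 - pmf (K w) q) / X))"
      using X by (subst sum_ennreal) (auto simp: v_def sum_divide_distrib pmf_le_1)
    also have "\<dots> \<le> mean_squared_error M \<pi> w est"
      unfolding mse by (intro sum_mono coord)
    finally show ?thesis .
  next
    case 2
    then show ?thesis
      using info_pos by (simp add: ennreal_top_mult)
  next
    case 3
    then show ?thesis
      using residence_time_nonzero[of K s w] by (auto simp: info ennreal_mult_top)
  qed auto
  then show ?thesis
    by (simp add: K_def s_def)
qed

end
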